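(* For each $N\ge 1$ let $R_N,T_N\in M_N(\mathbb{R})$ be deterministic symmetric positive semidefinite matrices of full rank, let $X_N$ be an $N\times N$ random matrix whose entries are independent real standard Gaussian random variables, and put $\theta_N=R_NX_NT_N$; all $X_N$ are defined on a common probability space. For $\gamma>0$ let $A_N^{(\gamma)}$ be the $N\times N$ random matrix with entries $(A_N^{(\gamma)})_{k,l}=\exp(\gamma\,\mathrm{i}\,(\theta_N)_{k,l})$, $1\le k,l\le N$, where $\mathrm{i}=\sqrt{-1}$. (1) For each fixed $N$, as $\gamma\to\infty$, the random vector $\big(\lambda_1(A_N^{(\gamma)}A_N^{(\gamma)*}),\ldots,\lambda_N(A_N^{(\gamma)}A_N^{(\gamma)*})\big)$ converges in distribution to $\big(\lambda_1(UU^* ),\ldots,\lambda_N(UU^* )\big)$, where $U$ is an $N\times N$ random matrix with i.i.d. entries uniformly distributed on the unit circle of $\mathbb{C}$. (2) Suppose that, almost surely, $F^{\theta_N\theta_N^*}\Rightarrow F$ as $N\to\infty$ for some compactly supported probability distribution $F$ on $\mathbb{R}$ (the asymptotic eigenvalue distribution of $\theta_N\theta_N^*$), and that almost surely the operator norm $\|\theta_N\theta_N^*\|$ converges as $N\to\infty$. Let $(\gamma_N)_{N\ge1}$ be a sequence of positive real numbers with $\gamma_N\to0$ as $N\to\infty$. Then, almost surely, $F^{\gamma_N^{-2}A_N^{(\gamma_N)}A_N^{(\gamma_N)*}}\Rightarrow F$ as $N\to\infty$.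
   Context: For a Hermitian $N\times N$ matrix $M$, $\lambda_1(M)\ge\cdots\ge\lambda_N(M)$ denote its ordered eigenvalues and $F^{M}$ denotes its empirical eigenvalue distribution, i.e. the probability measure $\frac1N\sum_{k=1}^N\delta_{\lambda_k(M)}$. The symbol $\Rightarrow$ denotes weak convergence of probability distributions. $M^*$ is the conjugate transpose. The matrices $R_N,T_N$ play the role of square roots of (not necessarily unit-diagonal) correlation matrices. *)

theory Defs
  imports
    "HOL-Probability.Probability"
    "Jordan_Normal_Form.Schur_Decomposition"
    "Jordan_Normal_Form.DL_Rank"
begin

definition symmetric_psd :: "nat \<Rightarrow> real mat \<Rightarrow> bool" where
  "symmetric_psd n A \<longleftrightarrow> A \<in> carrier_mat n n \<and> transpose_mat A = A \<and>
     (\<forall>v \<in> carrier_vec n. 0 \<le> scalar_prod v (mult_mat_vec A v))"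

text \<open>
  The eigenvalues with multiplicity, largest first.  Applied only to Hermitian matrices, where all
  roots of the characteristic polynomial are real, so that taking real parts loses nothing.
\<close>
definition ordered_eigenvalues :: "complex mat \<Rightarrow> real list" where
  "ordered_eigenvalues A = rev (sorted_list_of_multiset (image_mset Re (proots (char_poly A))))"

text \<open>
  The vector of ordered eigenvalues of an \<open>n\<close>-by-\<open>n\<close> matrix, counted from 0.  It is padded with
  zeros, so \<open>\<real>\<^sup>n\<close> is embedded in \<open>nat \<Rightarrow> real\<close> as a closed set which
  inherits its usual topology from the product topology.
\<close>
definition eigenvalue_vector :: "complex mat \<Rightarrow> nat \<Rightarrow> real" where
  "eigenvalue_vector A k = (if k < dim_row A then ordered_eigenvalues A ! k else 0)"

text \<open>The empirical distribution: the image of the uniform measure on the set of indices.\<close>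
definition esd :: "complex mat \<Rightarrow> real measure" where
  "esd A = distr (uniform_count_measure {..<dim_row A}) borel (eigenvalue_vector A)"

definition euclidean_norm :: "complex vec \<Rightarrow> real" where
  "euclidean_norm v = sqrt (\<Sum>i<dim_vec v. (cmod (vec_index v i))\<^sup>2)"

definition operator_norm :: "complex mat \<Rightarrow> real" where
  "operator_norm A =
     (SUP v \<in> {v \<in> carrier_vec (dim_col A). euclidean_norm v \<le> 1}. euclidean_norm (mult_mat_vec A v))"

definition iid_matrix ::
    "'a measure \<Rightarrow> nat \<Rightarrow> 'b::topological_space measure \<Rightarrow> ('a \<Rightarrow> 'b mat) \<Rightarrow> bool" where
  "iid_matrix M n \<mu> X \<longleftrightarrow>
     (\<forall>\<omega> \<in> space M. X \<omega> \<in> carrier_mat n n) \<and>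
     prob_space.indep_vars M (\<lambda>_. borel) (\<lambda>(k, l) \<omega>. X \<omega> $$ (k, l)) ({..<n} \<times> {..<n}) \<and>
     (\<forall>k<n. \<forall>l<n. distr M borel (\<lambda>\<omega>. X \<omega> $$ (k, l)) = \<mu>)"

definition std_gaussian :: "real measure" where
  "std_gaussian = density lborel std_normal_density"

definition circle_uniform :: "complex measure" where
  "circle_uniform = distr (uniform_measure lborel {0..2 * pi}) borel cis"

text \<open>
  The random elements \<open>Y i\<close> on \<open>M\<close> converge in distribution, along the filter, to the random
  element \<open>Z\<close>, which may live on a different probability space \<open>M'\<close>.
\<close>
definition converges_in_distribution ::
    "'a measure \<Rightarrow> ('i \<Rightarrow> 'a \<Rightarrow> 's::topological_space) \<Rightarrow> 'b measure \<Rightarrow> ('b \<Rightarrow> 's) \<Rightarrow> 'i filter \<Rightarrow> bool"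
  where
  "converges_in_distribution M Y M' Z Fl \<longleftrightarrow>
     (\<forall>\<^sub>F i in Fl. Y i \<in> borel_measurable M) \<and> Z \<in> borel_measurable M' \<and>
     (\<forall>f :: 's \<Rightarrow> real. continuous_on UNIV f \<and> bounded (range f) \<longrightarrow>
        ((\<lambda>i. \<integral>\<omega>. f (Y i \<omega>) \<partial>M) \<longlongrightarrow> (\<integral>\<omega>. f (Z \<omega>) \<partial>M')) Fl)"

definition compactly_supported :: "real measure \<Rightarrow> bool" where
  "compactly_supported F \<longleftrightarrow> (\<exists>K. compact K \<and> measure F K = 1)"

definition gram :: "complex mat \<Rightarrow> complex mat" where
  "gram A = A * mat_adjoint A"

definition phase_matrix :: "real \<Rightarrow> real mat \<Rightarrow> complex mat" where
  "phase_matrix \<gamma> \<theta> = map_mat (\<lambda>x. exp (complex_of_real \<gamma> * \<i> * complex_of_real x)) \<theta>"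

lemma length_ordered_eigenvalues:
  assumes A: "A \<in> carrier_mat n n"
  shows "length (ordered_eigenvalues A) = n"
proof -
  obtain es where es: "char_poly A = (\<Prod>a\<leftarrow>es. [:- a, 1:])" "length es = n"
    using char_poly_factorized[OF A] by auto
  have "proots (\<Prod>a\<leftarrow>xs. [:- a, 1:]) = mset xs" for xs :: "complex list"
  proof (induction xs)
    case (Cons x xs)
    have "(\<Prod>a\<leftarrow>xs. [:- a, 1:]) \<noteq> 0"
      by (auto simp: prod_list_zero_iff)
    then show ?case
      using Cons by (simp add: proots_mult del: mult_pCons_left)
  qed simp
  then have "proots (char_poly A) = mset es"
    unfolding es(1) .
  then show ?thesis
    using es(2) by (simp add: ordered_eigenvalues_def flip: size_mset)
qed

lemma prob_space_circle_uniform: "prob_space circle_uniform"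
proof -
  have "prob_space (uniform_measure lborel {0..2 * pi})"
    by (rule prob_space_uniform_measure) (auto simp: pi_gt_zero)
  moreover have "cis \<in> borel_measurable borel"
    by (rule borel_measurable_continuous_onI) (auto intro: continuous_intros)
  ultimately show ?thesis
    unfolding circle_uniform_def by (auto intro!: prob_space.prob_space_distr)
qed

lemma real_distribution_esd:
  assumes "dim_row A > 0"
  shows "real_distribution (esd A)"
proof -
  have "prob_space (uniform_count_measure {..<dim_row A})"
    using assms by (intro prob_space_uniform_count_measure) auto
  then have "prob_space (esd A)"
    unfolding esd_def
    by (rule prob_space.prob_space_distr)
       (simp add: measurable_def space_uniform_count_measure sets_uniform_count_measure)
  then show ?thesis
    by (auto simp: esd_def real_distribution_def real_distribution_axioms_def)
qed

end

theory Submission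
  imports Defs
begin

text \<open>
  (1) The entries of \<open>exp (\<i> \<gamma> \<theta>)\<close> lie on the unit circle.  A trigonometric monomial in them has expectation
  \<open>E exp (\<i> \<gamma> \<langle>e, R X T\<rangle>) = \<Prod> exp (- (\<gamma> m)\<^sup>2 / 2)\<close> with \<open>m = R\<^sup>T e T\<^sup>T\<close>, which is
  nonzero for \<open>e \<noteq> 0\<close> because \<open>R\<close> and \<open>T\<close> are invertible.  So all these expectations converge to
  those of uniform independent entries, and by Stone--Weierstrass on the torus so do the expectations of all
  continuous functions of the entries, in particular of the ordered eigenvalues.

  (2) No randomness is needed: \<open>-\<i>/\<gamma> exp (\<i> \<gamma> \<theta>) = \<theta> + c J + E\<close> with \<open>J\<close> the all-ones matrix and
  \<open>\<bar>E\<^sub>i\<^sub>l\<bar> \<le> \<gamma> \<theta>\<^sub>i\<^sub>l\<^sup>2 / 2\<close>.  A bound \<open>K\<close> on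
  \<open>\<parallel>\<theta> \<theta>\<^sup>*\<parallel>\<close> bounds every row sum of \<open>\<theta>\<^sub>i\<^sub>l\<^sup>2\<close>, hence the squared Frobenius norm of
  \<open>E\<close> is at most \<open>\<gamma>\<^sup>2 K\<^sup>2 N / 4 = o(N)\<close>.  Therefore \<open>E\<close> is small off \<open>o(N)\<close> directions, and a
  dimension count shows that the singular values of \<open>\<theta>\<close> and of the perturbed matrix agree up to a
  small error and a shift of the index by \<open>o(N)\<close>.
\<close>

unbundle no vec_syntax

section \<open>Unitary diagonalisation of Hermitian matrices\<close>

lemma mat_adjoint_carrier [simp]: "A \<in> carrier_mat n m \<Longrightarrow> mat_adjoint A \<in> carrier_mat m n"
  by (auto simp: mat_adjoint_def)

lemma dim_mat_adjoint [simp]: "dim_row (mat_adjoint A) = dim_col A" "dim_col (mat_adjoint A) = dim_row A"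
  by (auto simp: mat_adjoint_def)

lemma mat_adjoint_index [simp]:
  "i < dim_col A \<Longrightarrow> j < dim_row A \<Longrightarrow> mat_adjoint A $$ (i, j) = conjugate (A $$ (j, i))"
  by (auto simp: mat_adjoint_def mat_of_rows_def)

lemma mat_adjoint_mult:
  fixes A B :: "complex mat"
  assumes "A \<in> carrier_mat n m" "B \<in> carrier_mat m p"
  shows "mat_adjoint (A * B) = mat_adjoint B * mat_adjoint A"
  using assms by (intro eq_matI) (auto simp: scalar_prod_def mult.commute)

lemma mat_adjoint_mat_adjoint [simp]: "mat_adjoint (mat_adjoint A) = (A :: complex mat)"
  by (intro eq_matI) auto

text \<open>Gram-Schmidt on a basis that starts with \<open>v\<close> keeps \<open>v\<close> as its
  first vector. Its output is orthogonal but not normalised, so each column is divided by its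
  length; this is the only source of the scalar \<open>c\<close>.\<close>

lemma unitary_completion:
  fixes v :: "complex vec"
  assumes v: "v \<in> carrier_vec n" and v0: "v \<noteq> 0\<^sub>v n"
  obtains W c where "W \<in> carrier_mat n n" "mat_adjoint W * W = 1\<^sub>m n" "c \<noteq> 0" "col W 0 = c \<cdot>\<^sub>v v"
proof -
  interpret cof_vec_space n "TYPE(complex)" .
  from v v0 have n: "n > 0" by (cases n) auto
  define b where "b = basis_completion v"
  note b = basis_completion[OF v v0, folded b_def]
  define ws where "ws = gram_schmidt n b"
  note gs = gram_schmidt_result[OF b(2,4,5) ws_def]
  from b(6,7) n obtain vs where bv: "b = v # vs" by (cases b) auto
  from gram_schmidt_hd[OF v, of vs, folded bv] have hd: "hd ws = v" unfolding ws_def .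
  have len: "length ws = n" using gs b by auto
  hence ws0: "ws ! 0 = v" using hd n by (cases ws) auto
  have wsc: "ws ! i \<in> carrier_vec n" if "i < n" for i using gs(1-) len that by auto
  define r where "r i = sqrt (Re (ws ! i \<bullet>c ws ! i))" for i
  have orth: "ws ! i \<bullet>c ws ! j = 0 \<longleftrightarrow> i \<noteq> j" if "i < n" "j < n" for i j
    using gs len that by (auto dest: corthogonalD)
  have sq: "ws ! i \<bullet>c ws ! i = of_real (\<Sum>k<n. (cmod (ws ! i $ k))\<^sup>2)" if "i < n" for i
    using wsc[OF that] by (auto simp: scalar_prod_def atLeast0LessThan simp flip: complex_norm_square intro!: sum.cong)
  have r: "of_real (r i) * of_real (r i) = ws ! i \<bullet>c ws ! i" "r i \<noteq> 0" if "i < n" for i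
  proof -
    have "r i * r i = (\<Sum>k<n. (cmod (ws ! i $ k))\<^sup>2)"
      unfolding r_def sq[OF that] by (simp add: sum_nonneg)
    then show *: "complex_of_real (r i) * of_real (r i) = ws ! i \<bullet>c ws ! i"
      unfolding sq[OF that] by (metis of_real_mult)
    show "r i \<noteq> 0" using orth[OF that that] * by auto
  qed
  define W where "W = mat n n (\<lambda>(i, j). ws ! j $ i / of_real (r j))"
  have W: "W \<in> carrier_mat n n" by (simp add: W_def)
  have "mat_adjoint W * W = 1\<^sub>m n"
  proof (intro eq_matI)
    fix i j assume ij: "i < dim_row (1\<^sub>m n :: complex mat)" "j < dim_col (1\<^sub>m n :: complex mat)"
    hence "(mat_adjoint W * W) $$ (i, j) = (\<Sum>k<n. ws ! j $ k * cnj (ws ! i $ k)) / (of_real (r i) * of_real (r j))"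
      using W by (simp add: scalar_prod_def W_def atLeast0LessThan sum_divide_distrib mult.commute)
    also have "(\<Sum>k<n. ws ! j $ k * cnj (ws ! i $ k)) = ws ! j \<bullet>c ws ! i"
      using ij wsc[of i] wsc[of j] by (simp add: scalar_prod_def atLeast0LessThan)
    finally show "(mat_adjoint W * W) $$ (i, j) = 1\<^sub>m n $$ (i, j)"
      using ij orth[of j i] r[of i] by auto
  qed (use W in auto)
  moreover have "col W 0 = (1 / of_real (r 0)) \<cdot>\<^sub>v v"
    using n v by (intro eq_vecI) (auto simp: W_def ws0)
  moreover have "1 / complex_of_real (r 0) \<noteq> 0" using r n by auto
  ultimately show thesis using W that by blast
qed

definition diag_of :: "nat \<Rightarrow> (nat \<Rightarrow> complex) \<Rightarrow> complex mat" where
  "diag_of n d = mat n n (\<lambda>(i, j). if i = j then d i else 0)"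

lemma exists_eigenvector:
  fixes A :: "complex mat"
  assumes A: "A \<in> carrier_mat n n" and n: "n > 0"
  obtains v e where "v \<in> carrier_vec n" "v \<noteq> 0\<^sub>v n" "A *\<^sub>v v = e \<cdot>\<^sub>v v"
proof -
  from char_poly_factorized[OF A] obtain es where
    es: "char_poly A = (\<Prod>a\<leftarrow>es. [:- a, 1:])" "length es = n" by auto
  then obtain e es' where "es = e # es'" using n by (cases es) auto
  with es have "poly (char_poly A) e = 0" by (simp add: poly_prod_list)
  then have "eigenvalue A e" using eigenvalue_root_char_poly[OF A] by simp
  then show thesis using that A unfolding eigenvalue_def eigenvector_def by auto
qed

lemma mult_block_diagonal:
  fixes A :: "'b :: comm_ring_1 mat"
  assumes "a \<in> carrier_mat m m" "b \<in> carrier_mat m m" "A \<in> carrier_mat n n" "B \<in> carrier_mat n n"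
  shows "four_block_mat a (0\<^sub>m m n) (0\<^sub>m n m) A * four_block_mat b (0\<^sub>m m n) (0\<^sub>m n m) B =
    four_block_mat (a * b) (0\<^sub>m m n) (0\<^sub>m n m) (A * B)"
  using assms by (subst mult_four_block_mat[of _ m m _ n _ n _ _ m _ n]) auto

text \<open>Deflation by induction on \<open>n\<close>: an eigenvector completed to a unitary
  \<open>W\<close> splits off a one-by-one block, because a Hermitian matrix whose first column is a
  real multiple of the first unit vector has a first row of the same kind. Reality of
  \<open>d\<close> is not claimed here; for Gram matrices it comes out of the quadratic form in
  \<open>gram_eigenbasis\<close>.\<close>

lemma hermitian_unitarily_diagonalisable:
  fixes H :: "complex mat"
  assumes "H \<in> carrier_mat n n" "mat_adjoint H = H"
  shows "\<exists>U d. U \<in> carrier_mat n n \<and> mat_adjoint U * U = 1\<^sub>m n \<and> H = U * diag_of n d * mat_adjoint U"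
  using assms
proof (induction n arbitrary: H)
  case 0
  then show ?case
    by (intro exI[of _ "1\<^sub>m 0"] exI[of _ "\<lambda>_. 0"]) (auto simp: diag_of_def)
next
  case (Suc n)
  note H = Suc.prems(1) and herm = Suc.prems(2)
  obtain v e where v: "v \<in> carrier_vec (Suc n)" "v \<noteq> 0\<^sub>v (Suc n)" and ev: "H *\<^sub>v v = e \<cdot>\<^sub>v v"
    using exists_eigenvector[OF H] by blast
  obtain W c where W: "W \<in> carrier_mat (Suc n) (Suc n)" and un: "mat_adjoint W * W = 1\<^sub>m (Suc n)"
    and c: "c \<noteq> 0" "col W 0 = c \<cdot>\<^sub>v v"
    using unitary_completion[OF v] by blast
  let ?W = "mat_adjoint W"
  have W': "?W \<in> carrier_mat (Suc n) (Suc n)" using W by simp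
  have un': "W * ?W = 1\<^sub>m (Suc n)" using mat_mult_left_right_inverse[OF W' W un] .
  define G where "G = ?W * H * W"
  have G: "G \<in> carrier_mat (Suc n) (Suc n)" using H W by (auto simp: G_def)
  have hG: "mat_adjoint G = G"
    unfolding G_def using H W W' herm
    by (simp add: mat_adjoint_mult[of _ "Suc n" "Suc n" _ "Suc n"] assoc_mult_mat[of _ "Suc n" "Suc n" _ "Suc n" _ "Suc n"])
  have HG: "H = W * G * ?W"
  proof -
    have "W * G * ?W = (W * ?W) * H * (W * ?W)"
      unfolding G_def using H W W'
      by (simp add: assoc_mult_mat[of _ "Suc n" "Suc n" _ "Suc n" _ "Suc n"]
          mult_carrier_mat[of _ "Suc n" "Suc n" _ "Suc n"])
    then show ?thesis using un' H by simp
  qed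
  \<comment> \<open>Column 0 of \<open>W\<close> is a multiple of the eigenvector \<open>v\<close>,
    so column 0 of \<open>G\<close> is \<open>e\<close> times column 0 of the identity.\<close>
  have col0: "G $$ (i, 0) = (if i = 0 then e else 0)" if "i < Suc n" for i
  proof -
    have "G $$ (i, 0) = col G 0 $ i" using G that by simp
    also have "col G 0 = ?W *\<^sub>v (H *\<^sub>v col W 0)"
      unfolding G_def using H W W' col_dim[of W 0]
      by (simp add: col_mult2[of _ "Suc n" "Suc n" _ "Suc n"] assoc_mult_mat_vec[of _ "Suc n" "Suc n" _ "Suc n"]
          mult_carrier_mat[of _ "Suc n" "Suc n" _ "Suc n"])
    also have "H *\<^sub>v col W 0 = e \<cdot>\<^sub>v col W 0"
      unfolding c(2) using H v ev by (simp add: mult_mat_vec[OF H v(1)] smult_smult_assoc mult.commute)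
    also have "?W *\<^sub>v (e \<cdot>\<^sub>v col W 0) = e \<cdot>\<^sub>v (?W *\<^sub>v col W 0)"
      using W by (intro mult_mat_vec[OF W']) (metis carrier_vecI carrier_matD(1) dim_col)
    also have "?W *\<^sub>v col W 0 = col (?W * W) 0"
      using W W' by (simp add: col_mult2[of _ "Suc n" "Suc n" _ "Suc n"])
    finally show ?thesis using that unfolding un by auto
  qed
  have row0: "G $$ (0, j) = (if j = 0 then e else 0)" if "j < Suc n" for j
  proof (cases "j = 0")
    case False
    have "G $$ (0, j) = cnj (G $$ (j, 0))"
      using G that mat_adjoint_index[of 0 G j] hG by simp
    then show ?thesis using col0[OF that] False by simp
  qed (use col0 in simp)
  define K where "K = mat n n (\<lambda>(i, j). G $$ (Suc i, Suc j))"
  have K: "K \<in> carrier_mat n n" by (simp add: K_def)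
  have "mat_adjoint K = K"
  proof (intro eq_matI)
    fix i j assume "i < dim_row K" "j < dim_col K"
    then show "mat_adjoint K $$ (i, j) = K $$ (i, j)"
      using G hG mat_adjoint_index[of "Suc i" G "Suc j"] by (simp add: K_def)
  qed (simp_all add: K_def)
  with Suc.IH[OF K] obtain V d where V: "V \<in> carrier_mat n n" and uV: "mat_adjoint V * V = 1\<^sub>m n"
    and KV: "K = V * diag_of n d * mat_adjoint V" by blast
  define d' where "d' i = (case i of 0 \<Rightarrow> e | Suc i \<Rightarrow> d i)" for i
  \<comment> \<open>\<open>Z\<close> leaves the split-off coordinate fixed and diagonalises
    \<open>G\<close>, hence \<open>W * Z\<close> diagonalises \<open>H\<close>.\<close>
  define Z where "Z = four_block_mat (1\<^sub>m 1) (0\<^sub>m 1 n) (0\<^sub>m n 1) V"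
  have Z: "Z \<in> carrier_mat (Suc n) (Suc n)" using V by (auto simp: Z_def)
  have Z': "mat_adjoint Z = four_block_mat (1\<^sub>m 1) (0\<^sub>m 1 n) (0\<^sub>m n 1) (mat_adjoint V)"
    using V by (intro eq_matI) (auto simp: Z_def)
  have Zu: "mat_adjoint Z * Z = 1\<^sub>m (Suc n)"
    unfolding Z' unfolding Z_def using V uV
    by (subst mult_block_diagonal) (auto simp: four_block_one_mat simp del: One_nat_def)
  have D: "diag_of (Suc n) d' = four_block_mat (mat 1 1 (\<lambda>_. e)) (0\<^sub>m 1 n) (0\<^sub>m n 1) (diag_of n d)"
    by (intro eq_matI) (auto simp: diag_of_def d'_def split: nat.splits)
  have GZ: "G = Z * diag_of (Suc n) d' * mat_adjoint Z"
  proof -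
    have "Z * diag_of (Suc n) d' * mat_adjoint Z =
       four_block_mat (mat 1 1 (\<lambda>_. e)) (0\<^sub>m 1 n) (0\<^sub>m n 1) K"
      unfolding D Z' unfolding Z_def using V
      by (simp add: mult_block_diagonal[of _ 1 _ _ n] KV diag_of_def mult_carrier_mat[of _ n n _ n] del: One_nat_def)
    also have "\<dots> = G"
    proof (intro eq_matI)
      fix i j assume "i < dim_row G" "j < dim_col G"
      then show "four_block_mat (mat 1 1 (\<lambda>_. e)) (0\<^sub>m 1 n) (0\<^sub>m n 1) K $$ (i, j) = G $$ (i, j)"
        using G col0 row0 by (cases i; cases j) (auto simp: K_def)
    qed (use G in \<open>auto simp: K_def\<close>)
    finally show ?thesis by simp
  qed
  have Dc: "diag_of (Suc n) d' \<in> carrier_mat (Suc n) (Suc n)" by (simp add: diag_of_def)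
  have Zc': "mat_adjoint Z \<in> carrier_mat (Suc n) (Suc n)" using Z by simp
  note [simp] = assoc_mult_mat[of _ "Suc n" "Suc n" _ "Suc n" _ "Suc n"]
    mult_carrier_mat[of _ "Suc n" "Suc n" _ "Suc n"]
  show ?case
  proof (intro exI conjI)
    show "W * Z \<in> carrier_mat (Suc n) (Suc n)" using W Z by auto
    have "mat_adjoint (W * Z) * (W * Z) = mat_adjoint Z * (?W * W) * Z"
      using W W' Z Zc' by (simp add: mat_adjoint_mult[OF W Z] del: un)
    then show "mat_adjoint (W * Z) * (W * Z) = 1\<^sub>m (Suc n)"
      using Zu un right_mult_one_mat[OF Zc'] by simp
    show "H = W * Z * diag_of (Suc n) d' * mat_adjoint (W * Z)"
      unfolding mat_adjoint_mult[OF W Z] HG GZ using W W' Z Zc' Dc by simp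
  qed
qed

section \<open>Spectral form of Gram matrices\<close>

lemma gram_carrier [simp]: "B \<in> carrier_mat n m \<Longrightarrow> gram B \<in> carrier_mat n n"
  by (auto simp: gram_def)

lemma gram_index:
  "B \<in> carrier_mat n m \<Longrightarrow> i < n \<Longrightarrow> j < n \<Longrightarrow> gram B $$ (i, j) = (\<Sum>l<m. B $$ (i, l) * cnj (B $$ (j, l)))"
  by (auto simp: gram_def scalar_prod_def atLeast0LessThan)

lemma mat_adjoint_gram: "B \<in> carrier_mat n m \<Longrightarrow> mat_adjoint (gram B) = gram B"
  by (simp add: gram_def mat_adjoint_mult[of B n m _ n])

lemma proots_prod_list_linear: "proots (\<Prod>a\<leftarrow>xs. [:- a, 1:]) = mset (xs :: 'b :: idom list)"
proof (induction xs)
  case (Cons x xs)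
  have "(\<Prod>a\<leftarrow>xs. [:- a, 1:]) \<noteq> 0"
    by (auto simp: prod_list_zero_iff)
  then show ?case
    using Cons by (simp add: proots_mult del: mult_pCons_left)
qed simp

text \<open>Both sides are the Hermitian form at \<open>v\<close> of \<open>U\<close> times the
  diagonal matrix of \<open>d\<close> times the adjoint of \<open>U\<close>. With all weights equal
  to 1 this gives Parseval for a unitary matrix and, with \<open>B\<close> in place of
  \<open>U\<close>, the form of \<open>gram B\<close>.\<close>

lemma sum_weighted_coordinates:
  fixes U :: "nat \<Rightarrow> nat \<Rightarrow> complex"
  shows "(\<Sum>k<n. d k * of_real ((cmod (\<Sum>i<m. cnj (U i k) * v i))\<^sup>2)) =
    (\<Sum>i<m. \<Sum>j<m. v i * cnj (v j) * (\<Sum>k<n. U j k * d k * cnj (U i k)))"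
proof -
  have "(\<Sum>k<n. d k * of_real ((cmod (\<Sum>i<m. cnj (U i k) * v i))\<^sup>2)) =
     (\<Sum>k<n. \<Sum>i<m. \<Sum>j<m. v i * cnj (v j) * (U j k * d k * cnj (U i k)))"
    unfolding complex_norm_square cnj_sum sum_product unfolding sum_distrib_left
    by (intro sum.cong refl) (simp add: mult_ac)
  also have "\<dots> = (\<Sum>i<m. \<Sum>k<n. \<Sum>j<m. v i * cnj (v j) * (U j k * d k * cnj (U i k)))"
    by (rule sum.swap)
  also have "\<dots> = (\<Sum>i<m. \<Sum>j<m. \<Sum>k<n. v i * cnj (v j) * (U j k * d k * cnj (U i k)))"
    by (intro sum.cong refl sum.swap)
  finally show ?thesis by (simp add: sum_distrib_left)
qed

text \<open>Everything below uses the spectral theorem only through these scalar facts: Parseval for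
  the vectors \<open>u k\<close>, the diagonalised form of \<open>gram B\<close> (the squared length
  of the adjoint of \<open>B\<close> applied to \<open>v\<close>), unit length of each
  \<open>u k\<close>, and nonnegative eigenvalues in decreasing order.\<close>

lemma gram_eigenbasis:
  assumes B: "B \<in> carrier_mat n n"
  defines "ew \<equiv> eigenvalue_vector (gram B)"
  shows "\<exists>u :: nat \<Rightarrow> nat \<Rightarrow> complex.
      (\<forall>v. (\<Sum>k<n. (cmod (\<Sum>i<n. cnj (u k i) * v i))\<^sup>2) = (\<Sum>i<n. (cmod (v i))\<^sup>2)) \<and>
      (\<forall>v. (\<Sum>k<n. ew k * (cmod (\<Sum>i<n. cnj (u k i) * v i))\<^sup>2) =
        (\<Sum>l<n. (cmod (\<Sum>i<n. cnj (B $$ (i, l)) * v i))\<^sup>2)) \<and>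
      (\<forall>k<n. (\<Sum>i<n. (cmod (u k i))\<^sup>2) = 1)" (is ?basis)
    and "\<And>k. k < n \<Longrightarrow> 0 \<le> ew k"
    and "\<And>j k. j \<le> k \<Longrightarrow> k < n \<Longrightarrow> ew k \<le> ew j"
proof -
  let ?H = "gram B"
  have H: "?H \<in> carrier_mat n n" using B by simp
  obtain U d where U: "U \<in> carrier_mat n n" "mat_adjoint U * U = 1\<^sub>m n"
    and UD: "?H = U * diag_of n d * mat_adjoint U"
    using hermitian_unitarily_diagonalisable[OF H mat_adjoint_gram[OF B]] by blast
  have U': "mat_adjoint U \<in> carrier_mat n n" using U by simp
  have D: "diag_of n d \<in> carrier_mat n n" by (simp add: diag_of_def)
  have UU': "U * mat_adjoint U = 1\<^sub>m n" using mat_mult_left_right_inverse[OF U' U(1,2)] .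
  have orth1: "(\<Sum>k<n. U $$ (i, k) * cnj (U $$ (j, k))) = (if i = j then 1 else 0)" if "i < n" "j < n" for i j
    using arg_cong[OF UU', of "\<lambda>A. A $$ (i, j)"] that U by (simp add: scalar_prod_def atLeast0LessThan)
  have orth2: "(\<Sum>k<n. cnj (U $$ (k, i)) * U $$ (k, j)) = (if i = j then 1 else 0)" if "i < n" "j < n" for i j
    using arg_cong[OF U(2), of "\<lambda>A. A $$ (i, j)"] that U(1) by (simp add: scalar_prod_def atLeast0LessThan)
  have Hij: "?H $$ (i, j) = (\<Sum>k<n. U $$ (i, k) * d k * cnj (U $$ (j, k)))" if "i < n" "j < n" for i j
  proof -
    have "(U * diag_of n d) $$ (i, k) = U $$ (i, k) * d k" if "k < n" for k
    proof -
      have "(U * diag_of n d) $$ (i, k) = (\<Sum>l<n. U $$ (i, l) * (if l = k then d l else 0))"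
        using U(1) that \<open>i < n\<close> by (simp add: scalar_prod_def atLeast0LessThan diag_of_def)
      also have "\<dots> = (\<Sum>l<n. if l = k then U $$ (i, l) * d l else 0)"
        by (intro sum.cong) auto
      finally have "(U * diag_of n d) $$ (i, k) = (\<Sum>l<n. if l = k then U $$ (i, l) * d l else 0)" .
      then show ?thesis using that by simp
    qed
    moreover have "(M * mat_adjoint U) $$ (i, j) = (\<Sum>k<n. M $$ (i, k) * cnj (U $$ (j, k)))"
      if "M \<in> carrier_mat n n" for M
      using that U(1) \<open>i < n\<close> \<open>j < n\<close> by (simp add: scalar_prod_def atLeast0LessThan)
    ultimately show ?thesis
      unfolding UD using mult_carrier_mat[OF U(1) D] by simp
  qed
  have norm_eq: "(\<Sum>k<n. (cmod (\<Sum>i<n. cnj (U $$ (i, k)) * v i))\<^sup>2) = (\<Sum>i<n. (cmod (v i))\<^sup>2)" for v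
  proof -
    have "complex_of_real (\<Sum>k<n. (cmod (\<Sum>i<n. cnj (U $$ (i, k)) * v i))\<^sup>2) =
        (\<Sum>i<n. \<Sum>j<n. v i * cnj (v j) * (\<Sum>k<n. U $$ (j, k) * 1 * cnj (U $$ (i, k))))"
      using sum_weighted_coordinates[of "\<lambda>_. 1" "\<lambda>i k. U $$ (i, k)" v n n] by simp
    also have "\<dots> = (\<Sum>i<n. \<Sum>j<n. if j = i then v i * cnj (v j) else 0)"
      by (intro sum.cong refl) (simp add: orth1)
    also have "\<dots> = complex_of_real (\<Sum>i<n. (cmod (v i))\<^sup>2)"
      by (simp flip: complex_norm_square)
    finally show ?thesis unfolding of_real_eq_iff .
  qed
  have form_eq: "(\<Sum>k<n. d k * of_real ((cmod (\<Sum>i<n. cnj (U $$ (i, k)) * v i))\<^sup>2)) =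
      complex_of_real (\<Sum>l<n. (cmod (\<Sum>i<n. cnj (B $$ (i, l)) * v i))\<^sup>2)" for v
  proof -
    have "(\<Sum>k<n. d k * of_real ((cmod (\<Sum>i<n. cnj (U $$ (i, k)) * v i))\<^sup>2)) =
        (\<Sum>i<n. \<Sum>j<n. v i * cnj (v j) * (\<Sum>k<n. B $$ (j, k) * 1 * cnj (B $$ (i, k))))"
      unfolding sum_weighted_coordinates by (intro sum.cong refl) (simp add: gram_index[OF B] flip: Hij)
    also have "\<dots> = complex_of_real (\<Sum>l<n. (cmod (\<Sum>i<n. cnj (B $$ (i, l)) * v i))\<^sup>2)"
      using sum_weighted_coordinates[of "\<lambda>_. 1" "\<lambda>i k. B $$ (i, k)" v n n] by simp
    finally show ?thesis .
  qed
  \<comment> \<open>In the eigenbasis, column \<open>k\<close> of \<open>U\<close> has a single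
    coordinate 1 and zeros elsewhere, so the form at that column is \<open>d k\<close>; being a sum
    of squares, it is real and nonnegative.\<close>
  have d_nonneg: "d k = of_real (Re (d k))" "0 \<le> Re (d k)" if "k < n" for k
  proof -
    have "d k = (\<Sum>l<n. if l = k then d l else 0)" using that by simp
    also have "\<dots> = (\<Sum>l<n. d l * of_real ((cmod (\<Sum>i<n. cnj (U $$ (i, l)) * U $$ (i, k)))\<^sup>2))"
      by (intro sum.cong refl) (use that in \<open>auto simp: orth2\<close>)
    finally have *: "d k = complex_of_real (\<Sum>l<n. (cmod (\<Sum>i<n. cnj (B $$ (i, l)) * U $$ (i, k)))\<^sup>2)"
      unfolding form_eq .
    show "d k = of_real (Re (d k))" by (subst (1 2) *) simp
    show "0 \<le> Re (d k)" by (subst *) (simp add: sum_nonneg)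
  qed
  have "char_poly ?H = char_poly (diag_of n d)"
    by (rule char_poly_similar, rule similar_matI[of _ _ U "mat_adjoint U" n]) (use U U' D H UU' UD in auto)
  also have "\<dots> = (\<Prod>a\<leftarrow>diag_mat (diag_of n d). [:- a, 1:])"
    by (rule char_poly_upper_triangular[OF D]) (auto simp: diag_of_def)
  also have "diag_mat (diag_of n d) = map d [0..<n]" by (auto simp: diag_mat_def diag_of_def)
  finally have "proots (char_poly ?H) = mset (map d [0..<n])" by (simp only: proots_prod_list_linear)
  then have "mset (ordered_eigenvalues ?H) = mset (map (\<lambda>k. Re (d k)) [0..<n])"
    by (simp add: ordered_eigenvalues_def o_def flip: mset_map)
  \<comment> \<open>The diagonal and the sorted list agree only as multisets; \<open>p\<close>
    relabels the eigenvectors to follow the order of the list.\<close>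
  then obtain p where p: "p permutes {..<n}"
      "permute_list p (map (\<lambda>k. Re (d k)) [0..<n]) = ordered_eigenvalues ?H"
    using mset_eq_permutation[of "ordered_eigenvalues ?H" "map (\<lambda>k. Re (d k)) [0..<n]"] by auto
  have pn: "p k < n" if "k < n" for k using p(1) that permutes_in_image[OF p(1), of k] by simp
  have ew: "ew k = Re (d (p k))" if "k < n" for k
    using that pn[OF that] H by (simp add: ew_def eigenvalue_vector_def permute_list_def flip: p(2))
  have perm: "(\<Sum>k<n. f (p k)) = (\<Sum>k<n. f k)" for f :: "nat \<Rightarrow> real"
    using sum.permute[OF p(1), of f] by (simp add: o_def)
  show ?basis
  proof (intro exI[of _ "\<lambda>k i. U $$ (i, p k)"] conjI allI impI)
    fix v :: "nat \<Rightarrow> complex"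
    show "(\<Sum>k<n. (cmod (\<Sum>i<n. cnj (U $$ (i, p k)) * v i))\<^sup>2) = (\<Sum>i<n. (cmod (v i))\<^sup>2)"
      using perm[of "\<lambda>k. (cmod (\<Sum>i<n. cnj (U $$ (i, k)) * v i))\<^sup>2"] norm_eq by simp
  next
    fix v :: "nat \<Rightarrow> complex"
    have "(\<Sum>k<n. ew k * (cmod (\<Sum>i<n. cnj (U $$ (i, p k)) * v i))\<^sup>2) =
        (\<Sum>k<n. Re (d (p k)) * (cmod (\<Sum>i<n. cnj (U $$ (i, p k)) * v i))\<^sup>2)"
      by (simp add: ew)
    also have "\<dots> = (\<Sum>k<n. Re (d k) * (cmod (\<Sum>i<n. cnj (U $$ (i, k)) * v i))\<^sup>2)"
      by (rule perm)
    also have "\<dots> = (\<Sum>l<n. (cmod (\<Sum>i<n. cnj (B $$ (i, l)) * v i))\<^sup>2)"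
      using arg_cong[OF form_eq[of v], of Re] by simp
    finally show "(\<Sum>k<n. ew k * (cmod (\<Sum>i<n. cnj (U $$ (i, p k)) * v i))\<^sup>2) =
        (\<Sum>l<n. (cmod (\<Sum>i<n. cnj (B $$ (i, l)) * v i))\<^sup>2)" .
  next
    fix k assume k: "k < n"
    have "complex_of_real (\<Sum>i<n. (cmod (U $$ (i, p k)))\<^sup>2) = 1"
      using orth2[OF pn[OF k] pn[OF k]] by (simp add: complex_norm_square mult.commute del: of_real_power)
    then show "(\<Sum>i<n. (cmod (U $$ (i, p k)))\<^sup>2) = 1" by (metis of_real_eq_1_iff)
  qed
  show "0 \<le> ew k" if "k < n" for k using ew[OF that] d_nonneg(2)[OF pn[OF that]] by simp
  show "ew k \<le> ew j" if jk: "j \<le> k" "k < n" for j k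
  proof -
    have "sorted_wrt (\<ge>) (ordered_eigenvalues ?H)"
      by (simp add: ordered_eigenvalues_def sorted_wrt_rev)
    then have "ordered_eigenvalues ?H ! k \<le> ordered_eigenvalues ?H ! j" if "j < k"
      using jk that length_ordered_eigenvalues[OF H] by (simp add: sorted_wrt_iff_nth_less)
    then show "ew k \<le> ew j"
      using jk H by (cases "j = k") (auto simp: ew_def eigenvalue_vector_def)
  qed
qed

text \<open>Zero rows are appended to make the system square; its determinant then vanishes, which
  yields a nonzero kernel vector.\<close>

lemma homogeneous_system_nontrivial_solution:
  fixes w :: "nat \<Rightarrow> nat \<Rightarrow> 'b :: field"
  assumes "m < n"
  obtains v where "\<exists>i<n. v i \<noteq> 0" "\<And>j. j < m \<Longrightarrow> (\<Sum>i<n. w j i * v i) = 0"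
proof -
  define A where "A = mat n n (\<lambda>(j, i). if j < m then w j i else 0)"
  have A: "A \<in> carrier_mat n n" by (simp add: A_def)
  have "A = mat\<^sub>r n n (\<lambda>j. if j = m then 0\<^sub>v n else row A j)"
    using assms by (intro eq_matI) (auto simp: A_def)
  then have "det A = 0" using det_row_0[of m n "\<lambda>j. row A j"] assms A by auto
  then obtain v where v: "v \<in> carrier_vec n" "v \<noteq> 0\<^sub>v n" "A *\<^sub>v v = 0\<^sub>v n"
    using det_0_iff_vec_prod_zero[OF A] by auto
  show thesis
  proof (rule that[of "\<lambda>i. v $ i"])
    show "\<exists>i<n. v $ i \<noteq> 0" using v(1,2) by (metis eq_vecI carrier_vecD index_zero_vec(1) index_zero_vec(2))
    fix j assume j: "j < m"
    have "(A *\<^sub>v v) $ j = 0" using v(3) j assms by simp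
    then show "(\<Sum>i<n. w j i * v $ i) = 0"
      using j assms v(1) by (simp add: A_def scalar_prod_def atLeast0LessThan)
  qed
qed

section \<open>Perturbation of singular values\<close>

text \<open>The three families hold \<open>r\<close>, \<open>k\<close> and
  \<open>n - 1 - k - r\<close> equations, together \<open>n - 1\<close> equations in
  \<open>n\<close> unknowns.\<close>

lemma homogeneous_constraints_three:
  fixes a b c :: "nat \<Rightarrow> nat \<Rightarrow> 'b :: field"
  assumes "k + r < n"
  shows "\<exists>v. (\<exists>i<n. v i \<noteq> 0) \<and> (\<forall>j<r. (\<Sum>i<n. a j i * v i) = 0) \<and>
    (\<forall>j<k. (\<Sum>i<n. b j i * v i) = 0) \<and> (\<forall>j. k + r < j \<longrightarrow> j < n \<longrightarrow> (\<Sum>i<n. c j i * v i) = 0)"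
proof -
  \<comment> \<open>The third family starts at index \<open>k + r + 1\<close> but is stored from
    position \<open>k + r\<close> on, hence the \<open>Suc\<close>.\<close>
  define w where "w j = (if j < r then a j else if j < k + r then b (j - r) else c (Suc j))" for j
  from assms have "n - 1 < n" by simp
  then obtain v where v: "\<exists>i<n. v i \<noteq> 0" "\<And>j. j < n - 1 \<Longrightarrow> (\<Sum>i<n. w j i * v i) = 0"
    using homogeneous_system_nontrivial_solution[of "n - 1" n w] by blast
  show ?thesis
  proof (intro exI[of _ v] conjI allI impI v(1))
    fix j
    show "(\<Sum>i<n. a j i * v i) = 0" if "j < r"
      using v(2)[of j] that assms by (simp add: w_def)
    show "(\<Sum>i<n. b j i * v i) = 0" if "j < k"
      using v(2)[of "j + r"] that assms by (simp add: w_def)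
    show "(\<Sum>i<n. c j i * v i) = 0" if "k + r < j" "j < n"
      using v(2)[of "j - 1"] that assms by (cases j) (auto simp: w_def)
  qed
qed

text \<open>A Weyl inequality for singular values, the square roots of the Gram eigenvalues, with
  indices counted from 0. On a suitable vector the adjoint of \<open>B\<close> stretches by at least
  the singular value of \<open>B\<close> with index \<open>k + r\<close>, the adjoint of
  \<open>C\<close> by at most that of \<open>C\<close> with index \<open>k\<close>, and the two
  images differ by at most \<open>\<delta>\<close> times the length.\<close>

lemma sqrt_eigenvalue_shift:
  fixes B C :: "complex mat" and w :: "nat \<Rightarrow> nat \<Rightarrow> complex"
  assumes B: "B \<in> carrier_mat n n" and C: "C \<in> carrier_mat n n"
    and k: "k + r < n" and \<delta>: "0 \<le> \<delta>"
    and close: "\<And>v. (\<forall>j<r. (\<Sum>i<n. w j i * v i) = 0) \<Longrightarrow>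
      (\<Sum>l<n. (cmod (\<Sum>i<n. cnj (B $$ (i, l) - C $$ (i, l)) * v i))\<^sup>2) \<le> \<delta>\<^sup>2 * (\<Sum>i<n. (cmod (v i))\<^sup>2)"
  shows "sqrt (eigenvalue_vector (gram B) (k + r)) \<le> sqrt (eigenvalue_vector (gram C) k) + \<delta>"
proof -
  let ?b = "eigenvalue_vector (gram B)" and ?c = "eigenvalue_vector (gram C)"
  obtain p where p: "\<forall>v. (\<Sum>k<n. (cmod (\<Sum>i<n. cnj (p k i) * v i))\<^sup>2) = (\<Sum>i<n. (cmod (v i))\<^sup>2)"
      "\<forall>v. (\<Sum>k<n. ?b k * (cmod (\<Sum>i<n. cnj (p k i) * v i))\<^sup>2) =
        (\<Sum>l<n. (cmod (\<Sum>i<n. cnj (B $$ (i, l)) * v i))\<^sup>2)"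
      "\<forall>k<n. (\<Sum>i<n. (cmod (p k i))\<^sup>2) = 1"
    using gram_eigenbasis(1)[OF B] by blast
  note p = p[rule_format] and b = gram_eigenbasis(2,3)[OF B]
  obtain q where q: "\<forall>v. (\<Sum>k<n. (cmod (\<Sum>i<n. cnj (q k i) * v i))\<^sup>2) = (\<Sum>i<n. (cmod (v i))\<^sup>2)"
      "\<forall>v. (\<Sum>k<n. ?c k * (cmod (\<Sum>i<n. cnj (q k i) * v i))\<^sup>2) =
        (\<Sum>l<n. (cmod (\<Sum>i<n. cnj (C $$ (i, l)) * v i))\<^sup>2)"
      "\<forall>k<n. (\<Sum>i<n. (cmod (q k i))\<^sup>2) = 1"
    using gram_eigenbasis(1)[OF C] by blast
  note q = q[rule_format] and c = gram_eigenbasis(2,3)[OF C]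
  \<comment> \<open>Fewer than \<open>n\<close> constraints put \<open>v\<close> in the span of the top eigenvectors of one Gram matrix and
    in the span of the bottom eigenvectors of the other.\<close>
  obtain v where v: "\<exists>i<n. v i \<noteq> 0" "\<forall>j<r. (\<Sum>i<n. w j i * v i) = 0"
    "\<forall>j<k. (\<Sum>i<n. cnj (q j i) * v i) = 0"
    "\<forall>j. k + r < j \<longrightarrow> j < n \<longrightarrow> (\<Sum>i<n. cnj (p j i) * v i) = 0"
    using homogeneous_constraints_three[OF k, of w "\<lambda>j i. cnj (q j i)" "\<lambda>j i. cnj (p j i)"] by blast
  note v = v(1) v(2-4)[rule_format]
  define nv where "nv = (\<Sum>i<n. (cmod (v i))\<^sup>2)"
  have nv: "nv > 0"
  proof -
    from v(1) obtain i where "i < n" "v i \<noteq> 0" by blast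
    then show ?thesis unfolding nv_def by (intro sum_pos2[of _ i]) auto
  qed
  define f where "f l = (\<Sum>i<n. cnj (B $$ (i, l)) * v i)" for l
  define g where "g l = (\<Sum>i<n. cnj (C $$ (i, l)) * v i)" for l
  \<comment> \<open>Coordinates beyond \<open>k + r\<close> vanish by the choice of
    \<open>v\<close>; all others carry an eigenvalue of at least \<open>?b (k + r)\<close>.\<close>
  have "?b (k + r) * nv = (\<Sum>j<n. ?b (k + r) * (cmod (\<Sum>i<n. cnj (p j i) * v i))\<^sup>2)"
    unfolding nv_def p(1)[of v, symmetric] by (rule sum_distrib_left)
  also have "\<dots> \<le> (\<Sum>j<n. ?b j * (cmod (\<Sum>i<n. cnj (p j i) * v i))\<^sup>2)"
  proof (rule sum_mono)
    fix j assume "j \<in> {..<n}"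
    then show "?b (k + r) * (cmod (\<Sum>i<n. cnj (p j i) * v i))\<^sup>2 \<le> ?b j * (cmod (\<Sum>i<n. cnj (p j i) * v i))\<^sup>2"
      using v(4)[of j] b(2)[of j "k + r"] k by (cases "j \<le> k + r") (auto intro: mult_right_mono)
  qed
  also have "\<dots> = (\<Sum>l<n. (cmod (f l))\<^sup>2)" unfolding p(2) f_def ..
  finally have lower: "?b (k + r) * nv \<le> (\<Sum>l<n. (cmod (f l))\<^sup>2)" .
  \<comment> \<open>Here the first \<open>k\<close> coordinates vanish, so \<open>?c k\<close> is
    the largest weight left.\<close>
  have "(\<Sum>l<n. (cmod (g l))\<^sup>2) = (\<Sum>j<n. ?c j * (cmod (\<Sum>i<n. cnj (q j i) * v i))\<^sup>2)"
    unfolding q(2) g_def ..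
  also have "\<dots> \<le> (\<Sum>j<n. ?c k * (cmod (\<Sum>i<n. cnj (q j i) * v i))\<^sup>2)"
  proof (rule sum_mono)
    fix j assume "j \<in> {..<n}"
    then show "?c j * (cmod (\<Sum>i<n. cnj (q j i) * v i))\<^sup>2 \<le> ?c k * (cmod (\<Sum>i<n. cnj (q j i) * v i))\<^sup>2"
      using v(3)[of j] c(2)[of k j] by (cases "j < k") (auto intro: mult_right_mono)
  qed
  also have "\<dots> = ?c k * nv"
    unfolding nv_def q(1)[of v, symmetric] by (rule sum_distrib_left[symmetric])
  finally have upper: "(\<Sum>l<n. (cmod (g l))\<^sup>2) \<le> ?c k * nv" .
  have d2: "(\<Sum>l<n. (cmod (f l - g l))\<^sup>2) \<le> \<delta>\<^sup>2 * nv"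
    using close[of v] v(2) by (simp add: f_def g_def nv_def sum_subtractf left_diff_distrib)
  have diff: "L2_set (\<lambda>l. cmod (f l - g l)) {..<n} \<le> \<delta> * sqrt nv"
    unfolding L2_set_def using real_sqrt_le_mono[OF d2] \<delta> by (simp add: real_sqrt_mult)
  have "sqrt (?b (k + r)) * sqrt nv \<le> L2_set (\<lambda>l. cmod (f l)) {..<n}"
    unfolding L2_set_def using real_sqrt_le_mono[OF lower] by (simp add: real_sqrt_mult)
  also have "\<dots> \<le> L2_set (\<lambda>l. cmod (g l) + cmod (f l - g l)) {..<n}"
    by (rule L2_set_mono) (use norm_triangle_sub in \<open>auto simp: add.commute\<close>)
  also have "\<dots> \<le> L2_set (\<lambda>l. cmod (g l)) {..<n} + L2_set (\<lambda>l. cmod (f l - g l)) {..<n}"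
    by (rule L2_set_triangle_ineq)
  also have "L2_set (\<lambda>l. cmod (g l)) {..<n} \<le> sqrt (?c k) * sqrt nv"
    unfolding L2_set_def using real_sqrt_le_mono[OF upper] by (simp add: real_sqrt_mult)
  finally have "sqrt (?b (k + r)) * sqrt nv \<le> (sqrt (?c k) + \<delta>) * sqrt nv"
    using diff by (simp add: distrib_right)
  then show ?thesis using nv by simp
qed

text \<open>The eigenvalues of \<open>gram E\<close> add up to the squared Frobenius norm, and
  \<open>r + 1\<close> of them are at least the one of index \<open>r\<close>, which is therefore at
  most \<open>\<delta>\<^sup>2\<close>. The constraints \<open>w\<close> express orthogonality to
  the \<open>r\<close> leading eigenvectors.\<close>

lemma small_off_few_directions:
  fixes E :: "complex mat"
  assumes E: "E \<in> carrier_mat n n" and r: "r < n"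
    and frob: "(\<Sum>i<n. \<Sum>l<n. (cmod (E $$ (i, l)))\<^sup>2) \<le> (real r + 1) * \<delta>\<^sup>2"
  shows "\<exists>w :: nat \<Rightarrow> nat \<Rightarrow> complex. \<forall>v. (\<forall>j<r. (\<Sum>i<n. w j i * v i) = 0) \<longrightarrow>
      (\<Sum>l<n. (cmod (\<Sum>i<n. cnj (E $$ (i, l)) * v i))\<^sup>2) \<le> \<delta>\<^sup>2 * (\<Sum>i<n. (cmod (v i))\<^sup>2)"
proof -
  let ?e = "eigenvalue_vector (gram E)"
  obtain p where p: "\<forall>v. (\<Sum>k<n. (cmod (\<Sum>i<n. cnj (p k i) * v i))\<^sup>2) = (\<Sum>i<n. (cmod (v i))\<^sup>2)"
      "\<forall>v. (\<Sum>k<n. ?e k * (cmod (\<Sum>i<n. cnj (p k i) * v i))\<^sup>2) =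
        (\<Sum>l<n. (cmod (\<Sum>i<n. cnj (E $$ (i, l)) * v i))\<^sup>2)"
      "\<forall>k<n. (\<Sum>i<n. (cmod (p k i))\<^sup>2) = 1"
    using gram_eigenbasis(1)[OF E] by blast
  note p = p[rule_format] and e = gram_eigenbasis(2,3)[OF E]
  have "(real r + 1) * ?e r = (\<Sum>k<Suc r. ?e r)" by simp
  also have "\<dots> \<le> (\<Sum>k<Suc r. ?e k)" using r by (intro sum_mono e(2)) auto
  also have "\<dots> \<le> (\<Sum>k<n. ?e k)" using r by (intro sum_mono2 e(1)) auto
  also have "\<dots> = (\<Sum>k<n. \<Sum>i<n. ?e k * (cmod (p k i))\<^sup>2)"
    by (simp add: p(3) flip: sum_distrib_left)
  also have "\<dots> = (\<Sum>i<n. \<Sum>k<n. ?e k * (cmod (p k i))\<^sup>2)"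
    by (rule sum.swap)
  also have "\<dots> = (\<Sum>i<n. \<Sum>l<n. (cmod (E $$ (i, l)))\<^sup>2)"
  proof (rule sum.cong[OF refl])
    fix i assume i: "i \<in> {..<n}"
    have [simp]: "(\<Sum>j<n. cnj (a j) * (if j = i then 1 else 0)) = cnj (a i)" for a :: "nat \<Rightarrow> complex"
      using i by (simp add: if_distrib cong: if_cong)
    \<comment> \<open>The form at the \<open>i\<close>-th unit vector is the squared length of row
      \<open>i\<close> of \<open>E\<close>.\<close>
    show "(\<Sum>k<n. ?e k * (cmod (p k i))\<^sup>2) = (\<Sum>l<n. (cmod (E $$ (i, l)))\<^sup>2)"
      using p(2)[of "\<lambda>j. if j = i then 1 else 0"] by simp
  qed
  also note frob
  finally have "(real r + 1) * ?e r \<le> (real r + 1) * \<delta>\<^sup>2" .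
  then have er: "?e r \<le> \<delta>\<^sup>2"
    by (rule mult_left_le_imp_le) simp
  show ?thesis
  proof (intro exI[of _ "\<lambda>j i. cnj (p j i)"] allI impI)
    fix v assume v: "\<forall>j<r. (\<Sum>i<n. cnj (p j i) * v i) = 0"
    have "(\<Sum>l<n. (cmod (\<Sum>i<n. cnj (E $$ (i, l)) * v i))\<^sup>2) =
        (\<Sum>k<n. ?e k * (cmod (\<Sum>i<n. cnj (p k i) * v i))\<^sup>2)" by (simp add: p(2))
    also have "\<dots> \<le> (\<Sum>k<n. \<delta>\<^sup>2 * (cmod (\<Sum>i<n. cnj (p k i) * v i))\<^sup>2)"
    proof (rule sum_mono)
      fix k assume "k \<in> {..<n}"
      then show "?e k * (cmod (\<Sum>i<n. cnj (p k i) * v i))\<^sup>2 \<le> \<delta>\<^sup>2 * (cmod (\<Sum>i<n. cnj (p k i) * v i))\<^sup>2"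
        using v e(2)[of r k] er by (cases "k < r") (auto intro!: mult_right_mono)
    qed
    also have "\<dots> = \<delta>\<^sup>2 * (\<Sum>i<n. (cmod (v i))\<^sup>2)" by (simp add: p(1) flip: sum_distrib_left)
    finally show "(\<Sum>l<n. (cmod (\<Sum>i<n. cnj (E $$ (i, l)) * v i))\<^sup>2) \<le> \<delta>\<^sup>2 * (\<Sum>i<n. (cmod (v i))\<^sup>2)" .
  qed
qed

text \<open>The case \<open>r = 0\<close>, with an empty list of constraints: singular values are
  Lipschitz for the Frobenius norm. The continuity of the eigenvalues rests on this.\<close>

lemma sqrt_eigenvalue_frobenius:
  assumes B: "B \<in> carrier_mat n n" and C: "C \<in> carrier_mat n n" and k: "k < n"
  shows "sqrt (eigenvalue_vector (gram B) k) \<le>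
    sqrt (eigenvalue_vector (gram C) k) + sqrt (\<Sum>i<n. \<Sum>l<n. (cmod (B $$ (i, l) - C $$ (i, l)))\<^sup>2)"
proof -
  define \<delta> where "\<delta> = sqrt (\<Sum>i<n. \<Sum>l<n. (cmod (B $$ (i, l) - C $$ (i, l)))\<^sup>2)"
  have \<delta>: "\<delta> \<ge> 0" "\<delta>\<^sup>2 = (\<Sum>i<n. \<Sum>l<n. (cmod (B $$ (i, l) - C $$ (i, l)))\<^sup>2)"
    unfolding \<delta>_def by (auto simp: sum_nonneg)
  define E where "E = mat n n (\<lambda>(i, l). B $$ (i, l) - C $$ (i, l))"
  have E: "E \<in> carrier_mat n n" by (simp add: E_def)
  have n: "0 < n" using k by simp
  have "(\<Sum>i<n. \<Sum>l<n. (cmod (E $$ (i, l)))\<^sup>2) \<le> (real 0 + 1) * \<delta>\<^sup>2"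
    unfolding \<delta> by (simp add: E_def)
  note frob = this
  obtain w :: "nat \<Rightarrow> nat \<Rightarrow> complex" where
    "\<forall>v. (\<forall>j<0. (\<Sum>i<n. w j i * v i) = 0) \<longrightarrow>
      (\<Sum>l<n. (cmod (\<Sum>i<n. cnj (E $$ (i, l)) * v i))\<^sup>2) \<le> \<delta>\<^sup>2 * (\<Sum>i<n. (cmod (v i))\<^sup>2)"
    using small_off_few_directions[OF E n frob] by blast
  then have "sqrt (eigenvalue_vector (gram B) (k + 0)) \<le> sqrt (eigenvalue_vector (gram C) k) + \<delta>"
    using k \<delta>(1) by (intro sqrt_eigenvalue_shift[OF B C, where w = w]) (simp_all add: E_def del: complex_cnj_diff)
  then show ?thesis by (simp add: \<delta>_def)
qed

text \<open>A matrix with all entries equal to \<open>a\<close> has rank at most one, and its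
  adjoint kills every vector with coordinate sum 0. The constant thus costs a single further
  constraint whatever its size; in the application its modulus is \<open>1 / \<gamma>\<close>, which
  is unbounded.\<close>

lemma sqrt_eigenvalue_const_plus_small:
  fixes B C E :: "complex mat" and a :: complex
  assumes B: "B \<in> carrier_mat n n" and C: "C \<in> carrier_mat n n" and E: "E \<in> carrier_mat n n"
    and BC: "\<And>i l. i < n \<Longrightarrow> l < n \<Longrightarrow> B $$ (i, l) - C $$ (i, l) = a + E $$ (i, l)"
    and k: "k + Suc r < n" and \<delta>: "0 \<le> \<delta>"
    and frob: "(\<Sum>i<n. \<Sum>l<n. (cmod (E $$ (i, l)))\<^sup>2) \<le> (real r + 1) * \<delta>\<^sup>2"
  shows "sqrt (eigenvalue_vector (gram B) (k + Suc r)) \<le> sqrt (eigenvalue_vector (gram C) k) + \<delta>"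
proof -
  have rn: "r < n" using k by simp
  obtain w :: "nat \<Rightarrow> nat \<Rightarrow> complex" where w:
    "\<forall>v. (\<forall>j<r. (\<Sum>i<n. w j i * v i) = 0) \<longrightarrow>
      (\<Sum>l<n. (cmod (\<Sum>i<n. cnj (E $$ (i, l)) * v i))\<^sup>2) \<le> \<delta>\<^sup>2 * (\<Sum>i<n. (cmod (v i))\<^sup>2)"
    using small_off_few_directions[OF E rn frob] by blast
  \<comment> \<open>Position \<open>r\<close>, the last of the \<open>Suc r\<close> constraints,
    holds the coordinate sum.\<close>
  define w' where "w' j = (if j < r then w j else (\<lambda>_. 1))" for j
  show ?thesis
  proof (rule sqrt_eigenvalue_shift[OF B C k \<delta>, where w = w'])
    fix v assume v: "\<forall>j<Suc r. (\<Sum>i<n. w' j i * v i) = 0"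
    have v0: "(\<Sum>i<n. v i) = 0"
      using v[rule_format, of r] by (simp add: w'_def)
    have wv: "\<forall>j<r. (\<Sum>i<n. w j i * v i) = 0"
    proof (intro allI impI)
      fix j assume "j < r"
      then show "(\<Sum>i<n. w j i * v i) = 0" using v[rule_format, of j] by (simp add: w'_def)
    qed
    have eq: "(\<Sum>i<n. cnj (B $$ (i, l) - C $$ (i, l)) * v i) = (\<Sum>i<n. cnj (E $$ (i, l)) * v i)" if "l < n" for l
    proof -
      have "(\<Sum>i<n. cnj (B $$ (i, l) - C $$ (i, l)) * v i) = (\<Sum>i<n. cnj a * v i + cnj (E $$ (i, l)) * v i)"
        using that by (intro sum.cong refl) (simp add: BC distrib_right del: complex_cnj_diff)
      also have "\<dots> = cnj a * (\<Sum>i<n. v i) + (\<Sum>i<n. cnj (E $$ (i, l)) * v i)"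
        by (simp add: sum.distrib sum_distrib_left)
      finally show ?thesis using v0 by simp
    qed
    show "(\<Sum>l<n. (cmod (\<Sum>i<n. cnj (B $$ (i, l) - C $$ (i, l)) * v i))\<^sup>2) \<le> \<delta>\<^sup>2 * (\<Sum>i<n. (cmod (v i))\<^sup>2)"
      using w[rule_format, OF wv[rule_format]] by (simp add: eq del: complex_cnj_diff)
  qed
qed

section \<open>Empirical spectral distributions\<close>

lemma cdf_esd:
  assumes A: "A \<in> carrier_mat n n" and n: "n > 0"
  shows "cdf (esd A) x = real (card {k. k < n \<and> eigenvalue_vector A k \<le> x}) / real n"
proof -
  have dim: "dim_row A = n" using A by simp
  have "cdf (esd A) x = measure (uniform_count_measure {..<n}) (eigenvalue_vector A -` {..x} \<inter> {..<n})"
    unfolding cdf_def esd_def dim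
    by (subst measure_distr) (auto simp: measurable_def space_uniform_count_measure sets_uniform_count_measure)
  also have "eigenvalue_vector A -` {..x} \<inter> {..<n} = {k. k < n \<and> eigenvalue_vector A k \<le> x}" by auto
  finally show ?thesis using n by (subst (asm) measure_uniform_count_measure) auto
qed

text \<open>Adding \<open>s\<close> maps the indices counted for \<open>C\<close> injectively to
  indices counted for \<open>B\<close>, except for the at most \<open>s\<close> indices at the end
  that leave the range; these account for the error \<open>s / n\<close>.\<close>

lemma cdf_esd_gram_le:
  assumes B: "B \<in> carrier_mat n n" and C: "C \<in> carrier_mat n n" and n: "n > 0"
    and shift: "\<And>k. k + s < n \<Longrightarrow>
       sqrt (eigenvalue_vector (gram B) (k + s)) \<le> sqrt (eigenvalue_vector (gram C) k) + \<delta>"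
    and xy: "sqrt y + \<delta> \<le> sqrt x"
  shows "cdf (esd (gram C)) y \<le> cdf (esd (gram B)) x + real s / real n"
proof -
  let ?b = "eigenvalue_vector (gram B)" and ?c = "eigenvalue_vector (gram C)"
  have "{k. k < n \<and> ?c k \<le> y} \<subseteq> {k. k < n \<and> k + s < n \<and> ?c k \<le> y} \<union> {n - s..<n}" by auto
  then have "card {k. k < n \<and> ?c k \<le> y} \<le> card ({k. k < n \<and> k + s < n \<and> ?c k \<le> y} \<union> {n - s..<n})"
    by (intro card_mono) auto
  also have "\<dots> \<le> card {k. k < n \<and> k + s < n \<and> ?c k \<le> y} + card {n - s..<n}" by (rule card_Un_le)
  also have "card {n - s..<n} \<le> s" by auto
  also have "card {k. k < n \<and> k + s < n \<and> ?c k \<le> y} = card ((\<lambda>k. k + s) ` {k. k < n \<and> k + s < n \<and> ?c k \<le> y})"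
    by (rule card_image[symmetric]) (auto simp: inj_on_def)
  also have "\<dots> \<le> card {k. k < n \<and> ?b k \<le> x}"
  proof (intro card_mono, simp, clarsimp)
    fix k assume k: "k + s < n" "?c k \<le> y"
    have "sqrt (?b (k + s)) \<le> sqrt (?c k) + \<delta>" using shift[OF k(1)] .
    also have "\<dots> \<le> sqrt y + \<delta>" using k(2) by simp
    also note xy
    finally show "?b (k + s) \<le> x" by simp
  qed
  finally have "real (card {k. k < n \<and> ?c k \<le> y}) \<le> real (card {k. k < n \<and> ?b k \<le> x}) + real s" by linarith
  then show ?thesis
    using B C n by (simp add: cdf_esd[of _ n] divide_right_mono flip: add_divide_distrib)
qed

text \<open>At a continuity point of \<open>h\<close>, the values of \<open>g\<close> are squeezed
  between those of \<open>f\<close> at continuity points slightly to the left and to the right. The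
  error \<open>e\<close> may depend on both points, so the comparison is allowed to degenerate as
  \<open>y\<close> approaches \<open>x\<close>.\<close>

lemma weak_conv_sandwich:
  fixes f g :: "nat \<Rightarrow> real \<Rightarrow> real" and h :: "real \<Rightarrow> real"
  assumes f: "weak_conv f h" and h: "mono h"
    and fg: "\<And>x y. y < x \<Longrightarrow> \<exists>e. e \<longlonglongrightarrow> 0 \<and> (\<forall>\<^sub>F n in sequentially. f n y \<le> g n x + e n)"
    and gf: "\<And>x y. y < x \<Longrightarrow> \<exists>e. e \<longlonglongrightarrow> 0 \<and> (\<forall>\<^sub>F n in sequentially. g n y \<le> f n x + e n)"
  shows "weak_conv g h"
  unfolding weak_conv_def
proof (intro allI impI)
  fix x assume cont: "isCont h x"
  \<comment> \<open>A monotone function has only countably many discontinuities, so every open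
    interval contains a continuity point.\<close>
  have dense: "\<exists>y\<in>{a<..<b}. isCont h y" if "a < b" for a b
  proof -
    have "uncountable ({a<..<b} - {y. \<not> isCont h y})"
      using that mono_ctble_discont[OF h] by (intro uncountable_minus_countable) (auto simp: uncountable_open_interval)
    then have "{a<..<b} - {y. \<not> isCont h y} \<noteq> {}" using countable_empty by metis
    then show ?thesis by blast
  qed
  have tends: "(h \<longlongrightarrow> h x) (at x)" using cont by (simp add: isCont_def)
  show "(\<lambda>n. g n x) \<longlonglongrightarrow> h x"
  proof (rule order_tendstoI)
    fix a assume "a < h x"
    then have "eventually (\<lambda>y. a < h y) (at x)" using tends by (rule order_tendstoD(1)[rotated])
    then obtain d where d: "d > 0" "\<And>y. y \<noteq> x \<Longrightarrow> dist y x < d \<Longrightarrow> a < h y"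
      unfolding eventually_at by auto
    obtain y where y: "y \<in> {x - d<..<x}" "isCont h y" using dense[of "x - d" x] d(1) by auto
    have "a < h y" using d(2)[of y] y(1) by (auto simp: dist_real_def)
    obtain e where e: "e \<longlonglongrightarrow> 0" "\<forall>\<^sub>F n in sequentially. f n y \<le> g n x + e n"
      using fg[of y x] y(1) by auto
    have "(\<lambda>n. f n y - e n) \<longlonglongrightarrow> h y - 0"
      using f y(2) e(1) unfolding weak_conv_def by (intro tendsto_diff) auto
    then have "\<forall>\<^sub>F n in sequentially. a < f n y - e n"
      using \<open>a < h y\<close> by (intro order_tendstoD(1)) auto
    with e(2) show "\<forall>\<^sub>F n in sequentially. a < g n x" by eventually_elim simp
  next
    fix a assume "h x < a"
    then have "eventually (\<lambda>y. h y < a) (at x)" using tends by (rule order_tendstoD(2)[rotated])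
    then obtain d where d: "d > 0" "\<And>y. y \<noteq> x \<Longrightarrow> dist y x < d \<Longrightarrow> h y < a"
      unfolding eventually_at by auto
    obtain y where y: "y \<in> {x<..<x + d}" "isCont h y" using dense[of x "x + d"] d(1) by auto
    have "h y < a" using d(2)[of y] y(1) by (auto simp: dist_real_def)
    obtain e where e: "e \<longlonglongrightarrow> 0" "\<forall>\<^sub>F n in sequentially. g n x \<le> f n y + e n"
      using gf[of x y] y(1) by auto
    have "(\<lambda>n. f n y + e n) \<longlonglongrightarrow> h y + 0"
      using f y(2) e(1) unfolding weak_conv_def by (intro tendsto_add) auto
    then have "\<forall>\<^sub>F n in sequentially. f n y + e n < a"
      using \<open>h y < a\<close> by (intro order_tendstoD(2)) auto
    with e(2) show "\<forall>\<^sub>F n in sequentially. g n x < a" by eventually_elim simp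
  qed
qed

section \<open>Row norms and the operator norm of a Gram matrix\<close>

lemma cmod_index_le_euclidean_norm: "i < dim_vec v \<Longrightarrow> cmod (v $ i) \<le> euclidean_norm v"
  unfolding euclidean_norm_def
  by (rule real_le_rsqrt, rule member_le_sum) auto

lemma euclidean_norm_le_operator_norm:
  assumes A: "A \<in> carrier_mat n m" and v: "v \<in> carrier_vec m" "euclidean_norm v \<le> 1"
  shows "euclidean_norm (A *\<^sub>v v) \<le> operator_norm A"
  unfolding operator_norm_def
proof (rule cSUP_upper)
  show "v \<in> {v \<in> carrier_vec (dim_col A). euclidean_norm v \<le> 1}" using A v by auto
  \<comment> \<open>A supremum of reals dominates the members of a set only once the set is known to
    be bounded; the crude bound by absolute row sums suffices.\<close>
  show "bdd_above ((\<lambda>v. euclidean_norm (A *\<^sub>v v)) ` {v \<in> carrier_vec (dim_col A). euclidean_norm v \<le> 1})"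
  proof (rule bdd_aboveI2)
    fix w assume w: "w \<in> {v \<in> carrier_vec (dim_col A). euclidean_norm v \<le> 1}"
    have "cmod ((A *\<^sub>v w) $ i) \<le> (\<Sum>j<m. cmod (A $$ (i, j)))" if "i < n" for i
    proof -
      have "cmod ((A *\<^sub>v w) $ i) = cmod (\<Sum>j<m. A $$ (i, j) * w $ j)"
        using that A w by (auto simp: scalar_prod_def atLeast0LessThan)
      also have "\<dots> \<le> (\<Sum>j<m. cmod (A $$ (i, j)) * cmod (w $ j))"
        by (rule order_trans[OF norm_sum]) (simp add: norm_mult)
      also have "\<dots> \<le> (\<Sum>j<m. cmod (A $$ (i, j)) * 1)"
      proof (intro sum_mono mult_left_mono)
        fix j assume "j \<in> {..<m}"
        then show "cmod (w $ j) \<le> 1" using cmod_index_le_euclidean_norm[of j w] w A by auto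
      qed auto
      finally show ?thesis by simp
    qed
    then show "euclidean_norm (A *\<^sub>v w) \<le> sqrt (\<Sum>i<n. (\<Sum>j<m. cmod (A $$ (i, j)))\<^sup>2)"
      unfolding euclidean_norm_def using A by (auto intro!: sum_mono power_mono simp: dim_mult_mat_vec)
  qed
qed

text \<open>The squared length of row \<open>i\<close> is the \<open>i\<close>-th diagonal entry of
  \<open>gram B\<close>, hence a coordinate of the image of a unit vector.\<close>

lemma row_norm_le_operator_norm_gram:
  assumes B: "B \<in> carrier_mat n m" and i: "i < n"
  shows "(\<Sum>l<m. (cmod (B $$ (i, l)))\<^sup>2) \<le> operator_norm (gram B)"
proof -
  have G: "gram B \<in> carrier_mat n n" using B by simp
  have e: "euclidean_norm (unit_vec n i) \<le> 1"
  proof -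
    have "(\<Sum>j<n. (cmod (unit_vec n i $ j))\<^sup>2) = (\<Sum>j<n. if j = i then 1 else 0)"
      using i by (intro sum.cong) (auto simp: unit_vec_def)
    then show ?thesis using i by (simp add: euclidean_norm_def)
  qed
  have "complex_of_real (\<Sum>l<m. (cmod (B $$ (i, l)))\<^sup>2) = gram B $$ (i, i)"
    using gram_index[OF B i i] by (simp add: complex_norm_square del: of_real_power)
  also have "\<dots> = (gram B *\<^sub>v unit_vec n i) $ i" using G i by simp
  finally have "cmod (complex_of_real (\<Sum>l<m. (cmod (B $$ (i, l)))\<^sup>2)) = cmod ((gram B *\<^sub>v unit_vec n i) $ i)"
    by (rule arg_cong)
  then have "(\<Sum>l<m. (cmod (B $$ (i, l)))\<^sup>2) = cmod ((gram B *\<^sub>v unit_vec n i) $ i)"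
    unfolding norm_of_real by (simp add: sum_nonneg)
  also have "\<dots> \<le> euclidean_norm (gram B *\<^sub>v unit_vec n i)"
    using G i by (intro cmod_index_le_euclidean_norm) simp
  also have "\<dots> \<le> operator_norm (gram B)"
    using e by (intro euclidean_norm_le_operator_norm[OF G]) auto
  finally show ?thesis .
qed

text \<open>The squares in a row of \<open>\<theta>\<close> sum to at most \<open>K\<close>, so each
  single square is at most \<open>K\<close> too. The fourth powers in a row therefore sum to at most
  \<open>K\<^sup>2\<close>, and there are \<open>n\<close> rows.\<close>

lemma frobenius_quadratic_remainder:
  fixes E :: "complex mat" and \<theta> :: "real mat"
  assumes \<theta>: "\<theta> \<in> carrier_mat n n" and K: "operator_norm (gram (map_mat complex_of_real \<theta>)) \<le> K"
    and E: "\<And>i l. i < n \<Longrightarrow> l < n \<Longrightarrow> cmod (E $$ (i, l)) \<le> c * (\<theta> $$ (i, l))\<^sup>2"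
  shows "(\<Sum>i<n. \<Sum>l<n. (cmod (E $$ (i, l)))\<^sup>2) \<le> c\<^sup>2 * K\<^sup>2 * real n"
proof -
  have row: "(\<Sum>l<n. (\<theta> $$ (i, l))\<^sup>2) \<le> K" if "i < n" for i
    using row_norm_le_operator_norm_gram[of "map_mat complex_of_real \<theta>" n n i] that \<theta> K by simp
  have "(\<Sum>l<n. (cmod (E $$ (i, l)))\<^sup>2) \<le> c\<^sup>2 * K\<^sup>2" if i: "i < n" for i
  proof -
    have K0: "K \<ge> 0" using row[OF i] by (meson order_trans sum_nonneg zero_le_power2)
    have "(\<Sum>l<n. (cmod (E $$ (i, l)))\<^sup>2) \<le> (\<Sum>l<n. c\<^sup>2 * K * (\<theta> $$ (i, l))\<^sup>2)"
    proof (rule sum_mono)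
      fix l assume l: "l \<in> {..<n}"
      have "(\<theta> $$ (i, l))\<^sup>2 \<le> (\<Sum>l<n. (\<theta> $$ (i, l))\<^sup>2)" using l by (intro member_le_sum) auto
      then have t: "(\<theta> $$ (i, l))\<^sup>2 \<le> K" using row[OF i] by simp
      have "(cmod (E $$ (i, l)))\<^sup>2 \<le> (c * (\<theta> $$ (i, l))\<^sup>2)\<^sup>2"
        using E[of i l] i l by (intro power_mono) auto
      also have "\<dots> = c\<^sup>2 * (\<theta> $$ (i, l))\<^sup>2 * (\<theta> $$ (i, l))\<^sup>2" by (simp add: power2_eq_square)
      also have "\<dots> \<le> c\<^sup>2 * K * (\<theta> $$ (i, l))\<^sup>2"
        using t by (intro mult_right_mono mult_left_mono) auto
      finally show "(cmod (E $$ (i, l)))\<^sup>2 \<le> c\<^sup>2 * K * (\<theta> $$ (i, l))\<^sup>2" .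
    qed
    also have "\<dots> = c\<^sup>2 * K * (\<Sum>l<n. (\<theta> $$ (i, l))\<^sup>2)" by (simp add: sum_distrib_left)
    also have "\<dots> \<le> c\<^sup>2 * K * K" using row[OF i] K0 by (intro mult_left_mono) auto
    finally show ?thesis by (simp add: power2_eq_square mult.assoc)
  qed
  then have "(\<Sum>i<n. \<Sum>l<n. (cmod (E $$ (i, l)))\<^sup>2) \<le> (\<Sum>i<n. c\<^sup>2 * K\<^sup>2)"
    by (intro sum_mono) auto
  then show ?thesis by (simp add: mult.commute)
qed


text \<open>The error counts at most \<open>c / \<delta>\<^sup>2\<close> directions in which
  \<open>E\<close> may exceed \<open>\<delta>\<close>, plus one direction for the constant
  \<open>a\<close>.\<close>

lemma cdf_esd_const_plus_small:
  fixes B C E :: "complex mat" and a :: complex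
  assumes B: "B \<in> carrier_mat n n" and C: "C \<in> carrier_mat n n" and E: "E \<in> carrier_mat n n"
    and BC: "\<And>i l. i < n \<Longrightarrow> l < n \<Longrightarrow> B $$ (i, l) - C $$ (i, l) = a + E $$ (i, l)"
    and frob: "(\<Sum>i<n. \<Sum>l<n. (cmod (E $$ (i, l)))\<^sup>2) \<le> c"
    and n: "n > 0" and \<delta>: "\<delta> > 0" and xy: "sqrt y + \<delta> \<le> sqrt x"
  shows "cdf (esd (gram C)) y \<le> cdf (esd (gram B)) x + (c / \<delta>\<^sup>2 + 1) / real n"
proof -
  have c: "0 \<le> c" by (rule order_trans[OF _ frob]) (intro sum_nonneg zero_le_power2)
  \<comment> \<open>Rounding down keeps \<open>r\<close> below the desired error, while
    \<open>r + 1\<close> is large enough for the Frobenius bound.\<close>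
  define r where "r = nat \<lfloor>c / \<delta>\<^sup>2\<rfloor>"
  have cd: "0 \<le> c / \<delta>\<^sup>2" using c \<delta> by simp
  have r: "real r \<le> c / \<delta>\<^sup>2" "c / \<delta>\<^sup>2 \<le> real r + 1"
    unfolding r_def using cd by linarith+
  have "c \<le> (real r + 1) * \<delta>\<^sup>2" using r(2) \<delta> by (simp add: pos_divide_le_eq)
  then have frob': "(\<Sum>i<n. \<Sum>l<n. (cmod (E $$ (i, l)))\<^sup>2) \<le> (real r + 1) * \<delta>\<^sup>2" using frob by linarith
  have "cdf (esd (gram C)) y \<le> cdf (esd (gram B)) x + real (Suc r) / real n"
    using \<delta> by (intro cdf_esd_gram_le[OF B C n _ xy] sqrt_eigenvalue_const_plus_small[OF B C E BC _ _ frob']) auto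
  also have "real (Suc r) / real n \<le> (c / \<delta>\<^sup>2 + 1) / real n"
    using r(1) by (intro divide_right_mono) auto
  finally show ?thesis by simp
qed

lemma cdf_esd_gram_neg:
  assumes "B \<in> carrier_mat n n" "n > 0" "y < 0"
  shows "cdf (esd (gram B)) y = 0"
proof -
  have "{k. k < n \<and> eigenvalue_vector (gram B) k \<le> y} = {}"
    using gram_eigenbasis(2)[OF assms(1)] assms(3) by fastforce
  then show ?thesis using assms by (simp add: cdf_esd[of _ n])
qed

lemma cdf_ge_0: "0 \<le> cdf M x"
  by (simp add: cdf_def)

section \<open>Linearisation of the phase matrix\<close>

lemma gram_smult:
  assumes "A \<in> carrier_mat n m"
  shows "gram (c \<cdot>\<^sub>m A) = complex_of_real ((cmod c)\<^sup>2) \<cdot>\<^sub>m gram A"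
proof (intro eq_matI)
  fix i j assume "i < dim_row (complex_of_real ((cmod c)\<^sup>2) \<cdot>\<^sub>m gram A)" "j < dim_col (complex_of_real ((cmod c)\<^sup>2) \<cdot>\<^sub>m gram A)"
  then have ij: "i < n" "j < n" using gram_carrier[OF assms] by auto
  have "gram (c \<cdot>\<^sub>m A) $$ (i, j) = (\<Sum>l<m. (c * A $$ (i, l)) * cnj (c * A $$ (j, l)))"
    using ij assms by (subst gram_index[of _ n m]) auto
  also have "\<dots> = (c * cnj c) * (\<Sum>l<m. A $$ (i, l) * cnj (A $$ (j, l)))"
    by (simp add: sum_distrib_left mult_ac)
  finally show "gram (c \<cdot>\<^sub>m A) $$ (i, j) = (complex_of_real ((cmod c)\<^sup>2) \<cdot>\<^sub>m gram A) $$ (i, j)"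
    using ij gram_carrier[OF assms] by (simp add: gram_index[OF assms] complex_norm_square del: of_real_power)
qed (use assms in \<open>auto simp: gram_def\<close>)

text \<open>The first-order Taylor remainder of the exponential, divided by \<open>g\<close>.
  Multiplication by \<open>- \<i> / g\<close> turns the linear term into \<open>t\<close> and leaves
  a constant that is the same for all \<open>t\<close>.\<close>

lemma phase_matrix_expansion:
  assumes g: "g > 0"
  shows "cmod (- \<i> / of_real g * exp (of_real g * \<i> * of_real t) - of_real t - (- \<i> / of_real g)) \<le> g / 2 * t\<^sup>2"
proof -
  have "- \<i> / of_real g * exp (of_real g * \<i> * of_real t) - of_real t - (- \<i> / of_real g) =
      - \<i> / of_real g * (exp (\<i> * of_real (g * t)) - (\<Sum>k\<le>1. (\<i> * of_real (g * t)) ^ k / fact k))"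
    using g by (simp add: field_simps)
  also have "cmod \<dots> = 1 / g * cmod (exp (\<i> * of_real (g * t)) - (\<Sum>k\<le>1. (\<i> * of_real (g * t)) ^ k / fact k))"
    using g by (simp only: norm_mult norm_divide norm_minus_cancel norm_ii norm_of_real)
  also have "\<dots> \<le> 1 / g * (\<bar>g * t\<bar> ^ Suc 1 / fact (Suc 1))"
    using g by (intro mult_left_mono iexp_approx1) auto
  also have "\<dots> = g / 2 * t\<^sup>2"
    using g by (simp add: power2_eq_square abs_mult field_simps)
  finally show ?thesis .
qed

text \<open>The second limit for one fixed outcome: the rescaled phase matrix and
  \<open>\<theta> N\<close> differ by a constant matrix and a remainder whose squared Frobenius norm
  is \<open>o(N)\<close>, so their distribution functions can be compared at neighbouring
  points.\<close>

lemma weak_conv_phase_matrix: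
  fixes \<theta> :: "nat \<Rightarrow> real mat"
  assumes \<theta>: "\<And>N. N \<ge> 1 \<Longrightarrow> \<theta> N \<in> carrier_mat N N"
    and F: "real_distribution F"
    and conv: "weak_conv_m (\<lambda>N. esd (gram (map_mat complex_of_real (\<theta> N)))) F"
    and bounded: "convergent (\<lambda>N. operator_norm (gram (map_mat complex_of_real (\<theta> N))))"
    and \<gamma>: "\<And>N. N \<ge> 1 \<Longrightarrow> \<gamma> N > 0" "\<gamma> \<longlonglongrightarrow> 0"
  shows "weak_conv_m (\<lambda>N. esd (complex_of_real (1 / (\<gamma> N)\<^sup>2) \<cdot>\<^sub>m gram (phase_matrix (\<gamma> N) (\<theta> N)))) F"
proof -
  interpret F: real_distribution F by fact
  define C where "C N = map_mat complex_of_real (\<theta> N)" for N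
  \<comment> \<open>Scaling by \<open>a N\<close>, of modulus \<open>1 / \<gamma> N\<close>, puts
    the factor \<open>1 / (\<gamma> N)\<^sup>2\<close> on the Gram matrix; the same number is the
    constant term of the expansion.\<close>
  define a where "a N = - \<i> / complex_of_real (\<gamma> N)" for N
  define B where "B N = a N \<cdot>\<^sub>m phase_matrix (\<gamma> N) (\<theta> N)" for N
  define E where "E N = mat N N (\<lambda>(i, l). B N $$ (i, l) - C N $$ (i, l) - a N)" for N
  \<comment> \<open>A convergent sequence of norms supplies one bound for all
    \<open>N\<close>.\<close>
  obtain K where K: "\<And>N. operator_norm (gram (C N)) \<le> K"
  proof -
    from bounded have "Bseq (\<lambda>N. operator_norm (gram (C N)))"
      unfolding C_def by (rule convergent_imp_Bseq)
    then obtain K where "\<And>N. norm (operator_norm (gram (C N))) \<le> K" by (meson BseqE)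
    then have "operator_norm (gram (C N)) \<le> K" for N using abs_le_D1[of _ K] by simp
    then show thesis by (rule that)
  qed
  have P: "phase_matrix (\<gamma> N) (\<theta> N) \<in> carrier_mat N N" if "N \<ge> 1" for N
    using \<theta>[OF that] by (simp add: phase_matrix_def)
  have CN: "C N \<in> carrier_mat N N" and BN: "B N \<in> carrier_mat N N" and EN: "E N \<in> carrier_mat N N"
    if "N \<ge> 1" for N
    using \<theta>[OF that] P[OF that] by (auto simp: C_def B_def E_def)
  have gB: "gram (B N) = complex_of_real (1 / (\<gamma> N)\<^sup>2) \<cdot>\<^sub>m gram (phase_matrix (\<gamma> N) (\<theta> N))" if "N \<ge> 1" for N
    unfolding B_def gram_smult[OF P[OF that]]
    using \<gamma>(1)[OF that] by (simp add: a_def norm_divide power_divide)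
  have frob: "(\<Sum>i<N. \<Sum>l<N. (cmod (E N $$ (i, l)))\<^sup>2) \<le> (\<gamma> N / 2)\<^sup>2 * K\<^sup>2 * real N" if "N \<ge> 1" for N
  proof (rule frobenius_quadratic_remainder[OF \<theta>[OF that]])
    show "operator_norm (gram (map_mat complex_of_real (\<theta> N))) \<le> K" using K[of N] by (simp add: C_def)
    fix i l assume "i < N" "l < N"
    then show "cmod (E N $$ (i, l)) \<le> \<gamma> N / 2 * (\<theta> N $$ (i, l))\<^sup>2"
      using phase_matrix_expansion[OF \<gamma>(1)[OF that], of "\<theta> N $$ (i, l)"] \<theta>[OF that]
      by (simp add: E_def B_def C_def a_def phase_matrix_def)
  qed
  \<comment> \<open>Exchanging the two matrices changes the signs of the constant and of the
    remainder.\<close>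
  have frob': "(\<Sum>i<N. \<Sum>l<N. (cmod ((- E N) $$ (i, l)))\<^sup>2) \<le> (\<gamma> N / 2)\<^sup>2 * K\<^sup>2 * real N" if "N \<ge> 1" for N
    using frob[OF that] EN[OF that] by simp
  have small: "(\<lambda>N. (\<gamma> N / 2)\<^sup>2 * K\<^sup>2 / \<delta>\<^sup>2 + 1 / real N) \<longlonglongrightarrow> 0" if "\<delta> > 0" for \<delta>
  proof -
    have "(\<lambda>N. (\<gamma> N / 2)\<^sup>2 * K\<^sup>2 / \<delta>\<^sup>2 + 1 / real N) \<longlonglongrightarrow> (0 / 2)\<^sup>2 * K\<^sup>2 / \<delta>\<^sup>2 + 0"
      using that by (intro tendsto_intros \<gamma>(2) lim_1_over_n) auto
    then show ?thesis by simp
  qed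
  \<comment> \<open>Stated for arbitrary \<open>P\<close> and \<open>Q\<close>, as the sandwich
    needs the comparison in both directions.\<close>
  have compare: "\<exists>e. e \<longlonglongrightarrow> 0 \<and>
      (\<forall>\<^sub>F N in sequentially. cdf (esd (gram (P N))) y \<le> cdf (esd (gram (Q N))) x + e N)"
    if xy: "y < x" and P: "\<And>N. N \<ge> 1 \<Longrightarrow> P N \<in> carrier_mat N N" and Q: "\<And>N. N \<ge> 1 \<Longrightarrow> Q N \<in> carrier_mat N N"
      and D: "\<And>N. N \<ge> 1 \<Longrightarrow> D N \<in> carrier_mat N N"
      and QP: "\<And>N i l. N \<ge> 1 \<Longrightarrow> i < N \<Longrightarrow> l < N \<Longrightarrow> Q N $$ (i, l) - P N $$ (i, l) = b N + D N $$ (i, l)"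
      and fD: "\<And>N. N \<ge> 1 \<Longrightarrow> (\<Sum>i<N. \<Sum>l<N. (cmod (D N $$ (i, l)))\<^sup>2) \<le> (\<gamma> N / 2)\<^sup>2 * K\<^sup>2 * real N"
    for x y b and P Q D :: "nat \<Rightarrow> complex mat"
  proof (cases "y < 0")
    case True
    have "\<forall>\<^sub>F N in sequentially. cdf (esd (gram (P N))) y \<le> cdf (esd (gram (Q N))) x + 0"
      using eventually_ge_at_top[of 1]
    proof eventually_elim
      case (elim N)
      then show ?case using cdf_esd_gram_neg[OF P[OF elim] _ True] by (simp add: cdf_ge_0)
    qed
    then show ?thesis by (intro exI[of _ "\<lambda>_. 0"]) auto
  next
    case False
    \<comment> \<open>The tolerated perturbation is the gap between the square roots; it stays fixed
      while \<open>N\<close> grows.\<close>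
    define \<delta> where "\<delta> = sqrt x - sqrt y"
    have \<delta>: "\<delta> > 0" using xy by (simp add: \<delta>_def)
    have "cdf (esd (gram (P N))) y \<le> cdf (esd (gram (Q N))) x + ((\<gamma> N / 2)\<^sup>2 * K\<^sup>2 / \<delta>\<^sup>2 + 1 / real N)"
      if N: "N \<ge> 1" for N
    proof -
      have "cdf (esd (gram (P N))) y \<le>
          cdf (esd (gram (Q N))) x + ((\<gamma> N / 2)\<^sup>2 * K\<^sup>2 * real N / \<delta>\<^sup>2 + 1) / real N"
        by (rule cdf_esd_const_plus_small[OF Q[OF N] P[OF N] D[OF N] QP[OF N] fD[OF N] _ \<delta>])
           (use N in \<open>auto simp: \<delta>_def\<close>)
      then show ?thesis using N by (simp add: add_divide_distrib)
    qed
    then show ?thesis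
      by (intro exI[of _ "\<lambda>N. (\<gamma> N / 2)\<^sup>2 * K\<^sup>2 / \<delta>\<^sup>2 + 1 / real N"]
          conjI small[OF \<delta>] eventually_sequentiallyI[of 1])
  qed
  have "weak_conv (\<lambda>N. cdf (esd (gram (B N)))) (cdf F)"
  proof (rule weak_conv_sandwich)
    show "weak_conv (\<lambda>N. cdf (esd (gram (C N)))) (cdf F)"
      using conv by (simp add: weak_conv_m_def C_def)
    show "mono (cdf F)" by (intro monoI F.cdf_nondecreasing)
    fix x y :: real assume xy: "y < x"
    show "\<exists>e. e \<longlonglongrightarrow> 0 \<and>
      (\<forall>\<^sub>F N in sequentially. cdf (esd (gram (C N))) y \<le> cdf (esd (gram (B N))) x + e N)"
      using CN BN by (intro compare[OF xy _ _ EN _ frob, of C B a]) (auto simp: E_def)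
    show "\<exists>e. e \<longlonglongrightarrow> 0 \<and>
      (\<forall>\<^sub>F N in sequentially. cdf (esd (gram (B N))) y \<le> cdf (esd (gram (C N))) x + e N)"
      using CN BN EN by (intro compare[OF xy _ _ _ _ frob', of B C "\<lambda>N. - a N"]) (auto simp: E_def)
  qed
  then show ?thesis
    unfolding weak_conv_m_def weak_conv_def
  proof (elim all_forward imp_forward)
    \<comment> \<open>The scaling identity \<open>gB\<close> is available from \<open>N = 1\<close>
      on, so the limit is carried over by eventual equality.\<close>
    fix x assume "(\<lambda>N. cdf (esd (gram (B N))) x) \<longlonglongrightarrow> cdf F x"
    then show "(\<lambda>N. cdf (esd (complex_of_real (1 / (\<gamma> N)\<^sup>2) \<cdot>\<^sub>m gram (phase_matrix (\<gamma> N) (\<theta> N)))) x) \<longlonglongrightarrow> cdf F x"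
      by (rule Lim_transform_eventually) (use eventually_ge_at_top[of 1] in \<open>eventually_elim; simp only: gB\<close>)
  qed
qed

section \<open>Trigonometric polynomials on the torus\<close>

text \<open>Coordinates outside \<open>I\<close> are pinned to 1, which makes the set compact in the
  full function space.\<close>

definition torus :: "'i set \<Rightarrow> ('i \<Rightarrow> complex) set" where
  "torus I = {p. \<forall>i. cmod (p i) = 1 \<and> (i \<notin> I \<longrightarrow> p i = 1)}"

lemma compact_torus: "compact (torus I)"
proof -
  have "torus I = Pi\<^sub>E UNIV (\<lambda>i. if i \<in> I then sphere 0 1 else {1})"
    by (auto simp: torus_def PiE_def Pi_def split: if_splits; metis norm_one)
  moreover have "compactin (product_topology (\<lambda>i. euclidean) UNIV) (Pi\<^sub>E UNIV (\<lambda>i. if i \<in> I then sphere (0::complex) 1 else {1}))"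
    by (subst compactin_PiE) auto
  ultimately show ?thesis unfolding euclidean_product_topology by simp
qed

text \<open>Laurent polynomials, whose monomials restrict to the characters of the torus. The
  generating rules cover sums only; products and conjugates are represented by members that agree
  with them on the torus.\<close>

inductive_set trig_polys :: "'i set \<Rightarrow> (('i \<Rightarrow> complex) \<Rightarrow> complex) set" for I where
  monomial: "(\<lambda>p. c * (\<Prod>i\<in>I. p i powi n i)) \<in> trig_polys I"
| add: "f \<in> trig_polys I \<Longrightarrow> g \<in> trig_polys I \<Longrightarrow> (\<lambda>p. f p + g p) \<in> trig_polys I"

lemma torus_nonzero: "p \<in> torus I \<Longrightarrow> p i \<noteq> 0"
  by (auto simp: torus_def) (metis norm_zero zero_neq_one)

text \<open>Exponents of monomials add; for \<open>powi\<close> this relies on nonzero coordinates,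
  which the torus guarantees. Sums follow by distributivity in each argument.\<close>

lemma trig_polys_mult:
  assumes "f \<in> trig_polys I" "g \<in> trig_polys I"
  shows "\<exists>h\<in>trig_polys I. \<forall>p\<in>torus I. h p = f p * g p"
  using assms
proof (induction f)
  case (monomial c n)
  then show ?case
  proof (induction g)
    case (monomial d m)
    show ?case
      by (intro bexI[OF _ trig_polys.monomial[where I = I and c = "c * d" and n = "\<lambda>i. n i + m i"]])
         (auto simp: power_int_add torus_nonzero prod.distrib mult_ac)
  next
    case (add g1 g2)
    then obtain h1 h2 where "h1 \<in> trig_polys I" "h2 \<in> trig_polys I"
      "\<forall>p\<in>torus I. h1 p = c * (\<Prod>i\<in>I. p i powi n i) * g1 p"
      "\<forall>p\<in>torus I. h2 p = c * (\<Prod>i\<in>I. p i powi n i) * g2 p" by blast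
    then show ?case by (intro bexI[OF _ trig_polys.add[of h1 I h2]]) (auto simp: distrib_left)
  qed
next
  case (add f1 f2)
  then obtain h1 h2 where "h1 \<in> trig_polys I" "h2 \<in> trig_polys I"
    "\<forall>p\<in>torus I. h1 p = f1 p * g p" "\<forall>p\<in>torus I. h2 p = f2 p * g p" by blast
  then show ?case by (intro bexI[OF _ trig_polys.add[of h1 I h2]]) (auto simp: distrib_right)
qed

text \<open>On the unit circle the conjugate is the inverse, so conjugation negates the
  exponents.\<close>

lemma trig_polys_cnj:
  assumes "f \<in> trig_polys I"
  shows "\<exists>h\<in>trig_polys I. \<forall>p\<in>torus I. h p = cnj (f p)"
  using assms
proof (induction f)
  case (monomial c n)
  have "p i powi - n i = cnj (p i powi n i)" if "p \<in> torus I" for p i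
  proof -
    have "p i * cnj (p i) = 1" using that by (simp add: torus_def flip: complex_norm_square)
    then have "inverse (p i) = cnj (p i)" by (rule inverse_unique)
    then show ?thesis by (simp add: power_int_def)
  qed
  then show ?case
    by (intro bexI[OF _ trig_polys.monomial[where I = I and c = "cnj c" and n = "\<lambda>i. - n i"]])
       auto
next
  case (add f1 f2)
  then obtain h1 h2 where "h1 \<in> trig_polys I" "h2 \<in> trig_polys I"
    "\<forall>p\<in>torus I. h1 p = cnj (f1 p)" "\<forall>p\<in>torus I. h2 p = cnj (f2 p)" by blast
  then show ?case by (intro bexI[OF _ trig_polys.add[of h1 I h2]]) auto
qed

lemma continuous_on_trig_polys: "f \<in> trig_polys I \<Longrightarrow> continuous_on (torus I) f"
proof (induction f rule: trig_polys.induct)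
  case (monomial c n)
  have "continuous_on (torus I) (\<lambda>p. p i)" for i :: 'a
    by (rule continuous_on_subset[OF continuous_on_product_coordinates]) auto
  then show ?case by (intro continuous_intros) (auto simp: torus_nonzero)
qed (intro continuous_intros)

lemma trig_polys_coordinate:
  assumes "finite I" "i \<in> I"
  shows "(\<lambda>p. c * p i) \<in> trig_polys I"
proof -
  have "(\<Prod>j\<in>I. p j powi (if j = i then 1 else 0)) = p i" for p :: "'a \<Rightarrow> complex"
  proof -
    have "(\<Prod>j\<in>I. p j powi (if j = i then 1 else 0)) = (\<Prod>j\<in>I. if j = i then p j else 1)"
      by (intro prod.cong) auto
    then show ?thesis using assms by simp
  qed
  then show ?thesis using trig_polys.monomial[where I = I and c = c and n = "\<lambda>j. if j = i then 1 else 0"] by simp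
qed

lemma trig_polys_const: "(\<lambda>p. c) \<in> trig_polys I"
  using trig_polys.monomial[where I = I and c = c and n = "\<lambda>j. 0"] by simp

text \<open>Stone-Weierstrass, applied to the real algebra formed by the real parts of trigonometric
  polynomials on the compact torus.\<close>

lemma trig_polys_dense:
  fixes I :: "'i :: countable set"
  assumes I: "finite I" and f: "continuous_on (torus I) f" and e: "(e :: real) > 0"
  shows "\<exists>g\<in>trig_polys I. \<forall>p\<in>torus I. \<bar>f p - Re (g p)\<bar> < e"
proof -
  define A where "A = {f. \<exists>g\<in>trig_polys I. \<forall>p\<in>torus I. f p = Re (g p)}"
  have "function_ring_on A (torus I)"
  proof
    show "compact (torus I)" by (rule compact_torus)
    show "continuous_on (torus I) f" if fA: "f \<in> A" for f
    proof -
      from fA obtain g where g: "g \<in> trig_polys I" "\<forall>p\<in>torus I. f p = Re (g p)" by (auto simp: A_def)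
      have "continuous_on (torus I) (\<lambda>p. Re (g p))"
        using continuous_on_trig_polys[OF g(1)] by (rule continuous_on_Re)
      then show ?thesis using g(2) by (simp cong: continuous_on_cong)
    qed
    show "(\<lambda>x. f x + g x) \<in> A" if fg: "f \<in> A" "g \<in> A" for f g
    proof -
      from fg obtain f' g' where "f' \<in> trig_polys I" "\<forall>p\<in>torus I. f p = Re (f' p)"
        "g' \<in> trig_polys I" "\<forall>p\<in>torus I. g p = Re (g' p)" by (auto simp: A_def)
      then show ?thesis unfolding A_def
        by (intro CollectI bexI[OF _ trig_polys.add[of f' I g']]) auto
    qed
    show "(\<lambda>x. f x * g x) \<in> A" if fg: "f \<in> A" "g \<in> A" for f g
    proof -
      from fg obtain f' g' where f': "f' \<in> trig_polys I" "\<forall>p\<in>torus I. f p = Re (f' p)"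
        and g': "g' \<in> trig_polys I" "\<forall>p\<in>torus I. g p = Re (g' p)" by (auto simp: A_def)
      \<comment> \<open>A product of real parts is again a real part:
        \<open>Re f' * Re g' = Re (f' * (g' + cnj g') / 2)\<close>.\<close>
      obtain gc where gc: "gc \<in> trig_polys I" "\<forall>p\<in>torus I. gc p = cnj (g' p)"
        using trig_polys_cnj[OF g'(1)] by blast
      obtain h1 where h1: "h1 \<in> trig_polys I" "\<forall>p\<in>torus I. h1 p = f' p * (g' p + gc p)"
        using trig_polys_mult[OF f'(1) trig_polys.add[OF g'(1) gc(1)]] by blast
      obtain h2 where h2: "h2 \<in> trig_polys I" "\<forall>p\<in>torus I. h2 p = (1/2) * h1 p"
        using trig_polys_mult[OF trig_polys_const h1(1)] by blast
      have "f p * g p = Re (h2 p)" if "p \<in> torus I" for p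
      proof -
        have "h2 p = f' p * of_real (Re (g' p))"
          using h1 h2 gc that by (simp add: complex_add_cnj)
        then show ?thesis using f' g' that by simp
      qed
      then show ?thesis unfolding A_def using h2(1) by auto
    qed
    show "(\<lambda>_. c) \<in> A" for c
      unfolding A_def by (intro CollectI bexI[OF _ trig_polys_const[of "of_real c"]]) auto
    show "\<exists>f\<in>A. f x \<noteq> f y" if xy: "x \<in> torus I" "y \<in> torus I" "x \<noteq> y" for x y
    proof -
      from xy(3) obtain i where i: "x i \<noteq> y i" by auto
      with xy(1,2) have "i \<in> I" unfolding torus_def by (cases "i \<in> I") auto
      have *: "(\<lambda>p. Re (c * p i)) \<in> A" for c
        unfolding A_def
        by (intro CollectI bexI[OF _ trig_polys_coordinate[OF I \<open>i \<in> I\<close>, of c]] ballI refl)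
      \<comment> \<open>Multiplication by \<open>- \<i>\<close> turns the real part into the
        imaginary part, so one of the two functions separates the points.\<close>
      from i have "Re (1 * x i) \<noteq> Re (1 * y i) \<or> Re (- \<i> * x i) \<noteq> Re (- \<i> * y i)"
        by (auto simp: complex_eq_iff)
      then show ?thesis
        by (elim disjE) (erule bexI[OF _ *])+
    qed
  qed
  then interpret function_ring_on A "torus I" .
  from Stone_Weierstrass_basic[OF f e] obtain h where h: "h \<in> A" "\<forall>p\<in>torus I. \<bar>f p - h p\<bar> < e" by blast
  then obtain g where g: "g \<in> trig_polys I" "\<forall>p\<in>torus I. h p = Re (g p)" by (auto simp: A_def)
  show ?thesis using h(2) g by (intro bexI[OF _ g(1)]) simp
qed

section \<open>Expectations of continuous functions on the torus\<close>

lemma norm_monomial_torus: "p \<in> torus I \<Longrightarrow> cmod (\<Prod>i\<in>I. p i powi n i) = 1"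
  by (simp add: torus_def prod_norm[symmetric] norm_power_int)

lemma borel_measurable_power_int [measurable]:
  fixes f :: "'a \<Rightarrow> complex"
  assumes [measurable]: "f \<in> borel_measurable M"
  shows "(\<lambda>x. f x powi n) \<in> borel_measurable M"
  unfolding power_int_def by measurable

lemma integrable_trig_poly:
  assumes M: "prob_space M" and Y: "\<And>i. (\<lambda>\<omega>. Y \<omega> i) \<in> borel_measurable M" "AE \<omega> in M. Y \<omega> \<in> torus I"
    and g: "g \<in> trig_polys I"
  shows "integrable M (\<lambda>\<omega>. g (Y \<omega>))"
  using g
proof (induction g)
  case (monomial c n)
  interpret prob_space M by fact
  note Y(1)[measurable]
  show ?case
    by (rule integrable_const_bound[where B = "cmod c"])
       (use Y(2) in \<open>auto simp: norm_mult norm_monomial_torus\<close>)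
qed auto

lemma integral_torus_approx:
  fixes f :: "('i \<Rightarrow> complex) \<Rightarrow> real"
  assumes M: "prob_space M" and Y: "\<And>i. (\<lambda>\<omega>. Y \<omega> i) \<in> borel_measurable M" "AE \<omega> in M. Y \<omega> \<in> torus I"
    and g: "g \<in> trig_polys I" and f: "(\<lambda>\<omega>. f (Y \<omega>)) \<in> borel_measurable M"
    and fg: "\<forall>p\<in>torus I. \<bar>f p - Re (g p)\<bar> < e"
  shows "\<bar>(\<integral>\<omega>. f (Y \<omega>) \<partial>M) - Re (\<integral>\<omega>. g (Y \<omega>) \<partial>M)\<bar> \<le> e"
proof -
  interpret prob_space M by fact
  have ig: "integrable M (\<lambda>\<omega>. g (Y \<omega>))" by (rule integrable_trig_poly[OF M Y g])
  then have igR: "integrable M (\<lambda>\<omega>. Re (g (Y \<omega>)))" by simp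
  have d: "integrable M (\<lambda>\<omega>. f (Y \<omega>) - Re (g (Y \<omega>)))"
    by (rule integrable_const_bound[where B = e])
       (use Y(2) f fg igR in \<open>auto elim!: eventually_mono intro: less_imp_le\<close>)
  then have "integrable M (\<lambda>\<omega>. f (Y \<omega>))" using Bochner_Integration.integrable_add[OF d igR] by simp
  then have "(\<integral>\<omega>. f (Y \<omega>) \<partial>M) - Re (\<integral>\<omega>. g (Y \<omega>) \<partial>M) = (\<integral>\<omega>. f (Y \<omega>) - Re (g (Y \<omega>)) \<partial>M)"
    using igR ig by (simp add: integral_Re)
  also have "\<bar>\<dots>\<bar> \<le> (\<integral>\<omega>. \<bar>f (Y \<omega>) - Re (g (Y \<omega>))\<bar> \<partial>M)"
    by (rule integral_abs_bound)
  also have "\<dots> \<le> (\<integral>\<omega>. e \<partial>M)"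
    by (rule integral_mono_AE) (use Y(2) d fg in \<open>auto elim!: eventually_mono intro: less_imp_le\<close>)
  finally show ?thesis by (simp add: prob_space)
qed

text \<open>Convergence for monomials extends to trigonometric polynomials by linearity and to
  continuous functions by uniform approximation, with \<open>e / 3\<close> each for
  \<open>Y\<close>, for \<open>Z\<close> and for the polynomial.\<close>

lemma torus_convergence:
  fixes f :: "('i :: countable \<Rightarrow> complex) \<Rightarrow> real" and Y :: "'g \<Rightarrow> 'a \<Rightarrow> 'i \<Rightarrow> complex"
  assumes I: "finite I" and M: "prob_space M" and M': "prob_space M'"
    and Y: "\<And>\<gamma> i. (\<lambda>\<omega>. Y \<gamma> \<omega> i) \<in> borel_measurable M" "\<And>\<gamma>. AE \<omega> in M. Y \<gamma> \<omega> \<in> torus I"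
    and Z: "\<And>i. (\<lambda>\<omega>. Z \<omega> i) \<in> borel_measurable M'" "AE \<omega> in M'. Z \<omega> \<in> torus I"
    and mono: "\<And>n. ((\<lambda>\<gamma>. \<integral>\<omega>. (\<Prod>i\<in>I. Y \<gamma> \<omega> i powi n i) \<partial>M) \<longlongrightarrow> (\<integral>\<omega>. (\<Prod>i\<in>I. Z \<omega> i powi n i) \<partial>M')) Fl"
    and f: "continuous_on (torus I) f" "\<And>\<gamma>. (\<lambda>\<omega>. f (Y \<gamma> \<omega>)) \<in> borel_measurable M" "(\<lambda>\<omega>. f (Z \<omega>)) \<in> borel_measurable M'"
  shows "((\<lambda>\<gamma>. \<integral>\<omega>. f (Y \<gamma> \<omega>) \<partial>M) \<longlongrightarrow> (\<integral>\<omega>. f (Z \<omega>) \<partial>M')) Fl"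
proof (rule tendstoI)
  fix e :: real assume "e > 0"
  then have e: "e / 3 > 0" by simp
  obtain g where g: "g \<in> trig_polys I" "\<forall>p\<in>torus I. \<bar>f p - Re (g p)\<bar> < e / 3"
    using trig_polys_dense[OF I f(1) e] by blast
  have "((\<lambda>\<gamma>. \<integral>\<omega>. g (Y \<gamma> \<omega>) \<partial>M) \<longlongrightarrow> (\<integral>\<omega>. g (Z \<omega>) \<partial>M')) Fl"
    using g(1)
  proof (induction g)
    case (monomial c n)
    then show ?case using tendsto_mult[OF tendsto_const[of c] mono[of n]] by simp
  next
    case (add g1 g2)
    then show ?case
      using tendsto_add[OF add.IH]
      by (simp add: integrable_trig_poly[OF M Y] integrable_trig_poly[OF M' Z])
  qed
  then have "((\<lambda>\<gamma>. Re (\<integral>\<omega>. g (Y \<gamma> \<omega>) \<partial>M)) \<longlongrightarrow> Re (\<integral>\<omega>. g (Z \<omega>) \<partial>M')) Fl"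
    by (rule tendsto_Re)
  from tendstoD[OF this e]
  show "\<forall>\<^sub>F \<gamma> in Fl. dist (\<integral>\<omega>. f (Y \<gamma> \<omega>) \<partial>M) (\<integral>\<omega>. f (Z \<omega>) \<partial>M') < e"
  proof eventually_elim
    case (elim \<gamma>)
    show ?case
      using elim integral_torus_approx[OF M Y(1) Y(2) g(1) f(2) g(2), of \<gamma>] integral_torus_approx[OF M' Z g(1) f(3) g(2)]
      unfolding dist_real_def by linarith
  qed
qed

lemma integral_circle_uniform_power_int:
  "(\<integral>z. z powi n \<partial>circle_uniform) = (if n = 0 then 1 else 0)"
proof (cases "n = 0")
  case True
  interpret prob_space circle_uniform by (rule prob_space_circle_uniform)
  show ?thesis using True prob_space by simp
next
  case False
  have [measurable]: "cis \<in> borel_measurable borel"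
    by (rule borel_measurable_continuous_onI) (auto intro: continuous_intros)
  \<comment> \<open>Writing the uniform measure as a density brings the integral to Lebesgue
    measure, where the fundamental theorem of calculus applies.\<close>
  have dens: "uniform_measure lborel {0..2 * pi} = density lborel (\<lambda>x. ennreal (indicator {0..2 * pi} x / (2 * pi)))"
    unfolding uniform_measure_def
    by (intro density_cong) (auto simp: indicator_def divide_ennreal[symmetric] simp flip: ennreal_1)
  have "(\<integral>z. z powi n \<partial>circle_uniform) = (\<integral>t. cis (of_int n * t) \<partial>uniform_measure lborel {0..2 * pi})"
    unfolding circle_uniform_def by (subst integral_distr) (auto simp: cis_power_int)
  also have "\<dots> = (\<integral>t. (indicator {0..2 * pi} t / (2 * pi)) *\<^sub>R cis (of_int n * t) \<partial>lborel)"
    unfolding dens by (subst integral_density) auto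
  also have "\<dots> = (\<integral>t. indicator {0..2 * pi} t *\<^sub>R (cis (of_int n * t) / (2 * pi)) \<partial>lborel)"
    by (intro Bochner_Integration.integral_cong) (auto simp: indicator_def scaleR_conv_of_real)
  \<comment> \<open>The antiderivative of a nontrivial character has period \<open>2 * pi\<close>,
    so its two boundary values cancel.\<close>
  also have "\<dots> = - \<i> * iexp (of_int n * (2 * pi)) / (of_int n * (2 * pi)) - - \<i> * iexp (of_int n * 0) / (of_int n * (2 * pi))"
  proof (rule integral_FTC_atLeastAtMost)
    show "((\<lambda>t. - \<i> * iexp (of_int n * t) / (of_int n * (2 * pi))) has_vector_derivative cis (of_int n * x) / (2 * pi))
        (at x within {0..2 * pi})" for x
      using False
      by (auto intro!: derivative_eq_intros simp: cis_conv_exp has_vector_derivative_complex_iff Re_exp Im_exp field_simps)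
  qed (auto intro!: continuous_intros)
  also have "iexp (of_int n * (2 * pi)) = 1"
    using cis_multiple_2pi[of "of_int n"] by (simp add: cis_conv_exp mult_ac)
  finally show ?thesis using False by simp
qed

section \<open>Random phases\<close>

text \<open>The square root of each eigenvalue is Lipschitz in the Frobenius norm of the entries;
  since Gram eigenvalues are nonnegative, squaring gives back the eigenvalue itself.\<close>

lemma continuous_on_eigenvalue_vector_gram:
  "continuous_on UNIV (\<lambda>p :: nat \<times> nat \<Rightarrow> complex. eigenvalue_vector (gram (mat n n p)))"
proof (rule continuous_on_coordinatewise_then_product)
  fix k
  let ?e = "\<lambda>p :: nat \<times> nat \<Rightarrow> complex. eigenvalue_vector (gram (mat n n p)) k"
  show "continuous_on UNIV ?e"
  proof (cases "k < n")
    case False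
    then show ?thesis by (simp add: eigenvalue_vector_def gram_def)
  next
    case k: True
    have "continuous_on UNIV (\<lambda>p. sqrt (?e p))"
      unfolding continuous_on_def
    proof (intro ballI)
      fix q :: "nat \<times> nat \<Rightarrow> complex"
      let ?d = "\<lambda>p :: nat \<times> nat \<Rightarrow> complex. sqrt (\<Sum>i<n. \<Sum>l<n. (cmod (p (i, l) - q (i, l)))\<^sup>2)"
      have bound: "norm (sqrt (?e p) - sqrt (?e q)) \<le> ?d p" for p
      proof -
        have "mat n n p \<in> carrier_mat n n" "mat n n q \<in> carrier_mat n n" by auto
        from sqrt_eigenvalue_frobenius[OF this k] sqrt_eigenvalue_frobenius[OF this(2,1) k]
        show ?thesis by (simp add: norm_minus_commute[of "q _"] abs_le_iff)
      qed
      have "continuous_on UNIV ?d"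
        by (intro continuous_intros continuous_on_product_coordinates)
      from this[unfolded continuous_on_def, rule_format, of q] have "(?d \<longlongrightarrow> 0) (at q)" by simp
      then have "((\<lambda>p. sqrt (?e p) - sqrt (?e q)) \<longlongrightarrow> 0) (at q)"
        by (rule Lim_null_comparison[rotated]) (rule always_eventually, rule allI, rule bound)
      then show "((\<lambda>p. sqrt (?e p)) \<longlongrightarrow> sqrt (?e q)) (at q)" by (rule LIM_zero_cancel)
    qed
    then have "continuous_on UNIV (\<lambda>p. (sqrt (?e p))\<^sup>2)" by (rule continuous_on_power)
    moreover have "0 \<le> ?e p" for p using gram_eigenbasis(2)[of "mat n n p" n] k by simp
    ultimately show ?thesis by simp
  qed
qed

section \<open>Expectations of products over independent entries\<close>

lemma iid_matrix_measurable:
  assumes "prob_space M" "iid_matrix M n \<mu> X" "k < n" "l < n"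
  shows "(\<lambda>\<omega>. X \<omega> $$ (k, l)) \<in> borel_measurable M"
proof -
  interpret prob_space M by fact
  have "\<forall>i\<in>{..<n} \<times> {..<n}. (\<lambda>(k, l) \<omega>. X \<omega> $$ (k, l)) i \<in> borel_measurable M"
    using assms(2) unfolding iid_matrix_def indep_vars_def by blast
  from bspec[OF this, of "(k, l)"] show ?thesis using assms(3,4) by simp
qed

lemma integral_iid_entry:
  fixes g :: "'b :: topological_space \<Rightarrow> complex"
  assumes M: "prob_space M" and X: "iid_matrix M n \<mu> X" and kl: "k < n" "l < n"
    and g: "g \<in> borel_measurable borel"
  shows "(\<integral>\<omega>. g (X \<omega> $$ (k, l)) \<partial>M) = (\<integral>x. g x \<partial>\<mu>)"
proof -
  have "\<mu> = distr M borel (\<lambda>\<omega>. X \<omega> $$ (k, l))" using X kl unfolding iid_matrix_def by auto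
  then show ?thesis using integral_distr[OF iid_matrix_measurable[OF M X kl] g] by simp
qed

lemma integral_iid_prod:
  fixes g :: "nat \<times> nat \<Rightarrow> 'b :: topological_space \<Rightarrow> complex"
  assumes M: "prob_space M" and X: "iid_matrix M n \<mu> X"
    and g: "\<And>i. i \<in> {..<n} \<times> {..<n} \<Longrightarrow> g i \<in> borel_measurable borel"
    and int: "\<And>i. i \<in> {..<n} \<times> {..<n} \<Longrightarrow> integrable M (\<lambda>\<omega>. g i (X \<omega> $$ i))"
  shows "(\<integral>\<omega>. (\<Prod>i\<in>{..<n} \<times> {..<n}. g i (X \<omega> $$ i)) \<partial>M) = (\<Prod>i\<in>{..<n} \<times> {..<n}. \<integral>x. g i x \<partial>\<mu>)"
proof -
  interpret prob_space M by fact
  have "indep_vars (\<lambda>_. borel) (\<lambda>(k, l) \<omega>. X \<omega> $$ (k, l)) ({..<n} \<times> {..<n})"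
    using X by (simp add: iid_matrix_def)
  then have "indep_vars (\<lambda>_. borel) (\<lambda>i \<omega>. g i ((\<lambda>(k, l) \<omega>. X \<omega> $$ (k, l)) i \<omega>)) ({..<n} \<times> {..<n})"
    by (rule indep_vars_compose2) (use g in auto)
  moreover have "(\<lambda>i \<omega>. g i ((\<lambda>(k, l) \<omega>. X \<omega> $$ (k, l)) i \<omega>)) = (\<lambda>i \<omega>. g i (X \<omega> $$ i))" by (auto simp: fun_eq_iff)
  ultimately have ind: "indep_vars (\<lambda>_. borel) (\<lambda>i \<omega>. g i (X \<omega> $$ i)) ({..<n} \<times> {..<n})" by simp
  have "(\<integral>\<omega>. (\<Prod>i\<in>{..<n} \<times> {..<n}. g i (X \<omega> $$ i)) \<partial>M) = (\<Prod>i\<in>{..<n} \<times> {..<n}. \<integral>\<omega>. g i (X \<omega> $$ i) \<partial>M)"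
    by (rule indep_vars_lebesgue_integral[OF _ ind int]) auto
  also have "\<dots> = (\<Prod>i\<in>{..<n} \<times> {..<n}. \<integral>x. g i x \<partial>\<mu>)"
    by (intro prod.cong refl) (use integral_iid_entry[OF M X] g in auto)
  finally show ?thesis .
qed

text \<open>Embeds matrices into the product space over \<open>nat \<times> nat\<close>, which carries a topology, unlike the type of
  matrices; the padding value 1 keeps unimodular matrices on the torus.\<close>
definition pad :: "nat \<Rightarrow> complex mat \<Rightarrow> nat \<times> nat \<Rightarrow> complex" where
  "pad n A i = (if i \<in> {..<n} \<times> {..<n} then A $$ i else 1)"

lemma mat_pad: "A \<in> carrier_mat n n \<Longrightarrow> mat n n (pad n A) = A"
  by (intro eq_matI) (auto simp: pad_def)

lemma AE_circle_uniform_norm: "AE z in circle_uniform. cmod z = 1"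
proof -
  have [measurable]: "cis \<in> borel_measurable borel"
    by (rule borel_measurable_continuous_onI) (auto intro: continuous_intros)
  show ?thesis unfolding circle_uniform_def by (subst AE_distr_iff) auto
qed

text \<open>Only the laws of the entries are prescribed, so unimodularity holds off a null set for
  each entry, and there are finitely many entries.\<close>

lemma iid_circle_uniform_torus:
  assumes M: "prob_space M" and U: "iid_matrix M n circle_uniform U"
  shows "AE \<omega> in M. pad n (U \<omega>) \<in> torus ({..<n} \<times> {..<n})"
proof -
  have "AE \<omega> in M. cmod (U \<omega> $$ i) = 1" if i: "i \<in> {..<n} \<times> {..<n}" for i
  proof -
    obtain k l where kl: "i = (k, l)" "k < n" "l < n" using i by auto
    have eq: "circle_uniform = distr M borel (\<lambda>\<omega>. U \<omega> $$ (k, l))" using U kl unfolding iid_matrix_def by auto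
    have "AE z in distr M borel (\<lambda>\<omega>. U \<omega> $$ (k, l)). cmod z = 1"
      using AE_circle_uniform_norm unfolding eq .
    then show ?thesis
      unfolding kl(1) by (subst (asm) AE_distr_iff[OF iid_matrix_measurable[OF M U kl(2,3)]]) auto
  qed
  then have "AE \<omega> in M. \<forall>i\<in>{..<n} \<times> {..<n}. cmod (U \<omega> $$ i) = 1"
    by (intro AE_finite_allI) auto
  then show ?thesis by eventually_elim (auto simp: torus_def pad_def)
qed

text \<open>Independence reduces the expectation to integrals over single circles, where every
  nontrivial power averages to 0.\<close>

lemma integral_circle_monomial:
  assumes M: "prob_space M" and U: "iid_matrix M n circle_uniform U"
  shows "(\<integral>\<omega>. (\<Prod>i\<in>{..<n} \<times> {..<n}. pad n (U \<omega>) i powi e i) \<partial>M) =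
    (\<Prod>i\<in>{..<n} \<times> {..<n}. if e i = 0 then 1 else 0)"
proof -
  interpret prob_space M by fact
  have int: "integrable M (\<lambda>\<omega>. U \<omega> $$ i powi e i)" if i: "i \<in> {..<n} \<times> {..<n}" for i
  proof (rule integrable_const_bound[where B = 1])
    obtain k l where kl: "i = (k, l)" "k < n" "l < n" using i by auto
    note iid_matrix_measurable[OF M U kl(2,3), measurable]
    show "(\<lambda>\<omega>. U \<omega> $$ i powi e i) \<in> borel_measurable M" unfolding kl(1) by measurable
    show "AE \<omega> in M. cmod (U \<omega> $$ i powi e i) \<le> 1"
      using iid_circle_uniform_torus[OF M U]
    proof eventually_elim
      case (elim \<omega>)
      then have "cmod (pad n (U \<omega>) i) = 1" unfolding torus_def by blast
      then show ?case using i by (simp add: pad_def norm_power_int)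
    qed
  qed
  have "(\<integral>\<omega>. (\<Prod>i\<in>{..<n} \<times> {..<n}. pad n (U \<omega>) i powi e i) \<partial>M) =
      (\<integral>\<omega>. (\<Prod>i\<in>{..<n} \<times> {..<n}. U \<omega> $$ i powi e i) \<partial>M)"
    by (intro Bochner_Integration.integral_cong prod.cong refl) (simp add: pad_def)
  also have "\<dots> = (\<Prod>i\<in>{..<n} \<times> {..<n}. \<integral>z. z powi e i \<partial>circle_uniform)"
    by (rule integral_iid_prod[OF M U _ int]) auto
  finally show ?thesis by (simp add: integral_circle_uniform_power_int)
qed

section \<open>Gaussian phases at high frequency\<close>

lemma nonzero_det_inverse:
  fixes A :: "'b :: field mat"
  assumes A: "A \<in> carrier_mat n n" and d: "det A \<noteq> 0"
  obtains B where "B \<in> carrier_mat n n" "B * A = 1\<^sub>m n" "A * B = 1\<^sub>m n"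
  using det_non_zero_imp_unit[OF A d, of "()"] unfolding Units_def ring_mat_def by auto

text \<open>The sums in \<open>zero\<close> are the entries of the transpose of \<open>R\<close>,
  times the matrix of \<open>e\<close>, times the transpose of \<open>T\<close>; both outer factors
  are invertible and can be cancelled.\<close>

lemma bilinear_coefficients_eq_0:
  fixes R T :: "real mat" and e :: "nat \<times> nat \<Rightarrow> real"
  assumes R: "R \<in> carrier_mat n n" "det R \<noteq> 0" and T: "T \<in> carrier_mat n n" "det T \<noteq> 0"
    and zero: "\<And>a b. a < n \<Longrightarrow> b < n \<Longrightarrow> (\<Sum>k<n. \<Sum>l<n. e (k, l) * R $$ (k, a) * T $$ (b, l)) = 0"
    and kl: "k < n" "l < n"
  shows "e (k, l) = 0"
proof -
  let ?R = "transpose_mat R" and ?T = "transpose_mat T"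
  define E where "E = mat n n e"
  have E: "E \<in> carrier_mat n n" by (simp add: E_def)
  have RT: "?R \<in> carrier_mat n n" "?T \<in> carrier_mat n n" using R T by auto
  obtain P where P: "P \<in> carrier_mat n n" "P * ?R = 1\<^sub>m n"
    using nonzero_det_inverse[OF RT(1)] R det_transpose[OF R(1)] by metis
  obtain Q where Q: "Q \<in> carrier_mat n n" "?T * Q = 1\<^sub>m n"
    using nonzero_det_inverse[OF RT(2)] T det_transpose[OF T(1)] by metis
  have "?R * (E * ?T) = 0\<^sub>m n n"
  proof (intro eq_matI)
    fix a b assume "a < dim_row (0\<^sub>m n n :: real mat)" "b < dim_col (0\<^sub>m n n :: real mat)"
    then have ab: "a < n" "b < n" by auto
    have ET: "(E * ?T) $$ (k, b) = (\<Sum>l<n. e (k, l) * T $$ (b, l))" if "k < n" for k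
      using that ab T by (simp add: E_def scalar_prod_def atLeast0LessThan)
    have "(?R * M) $$ (a, b) = (\<Sum>k<n. R $$ (k, a) * M $$ (k, b))" if "M \<in> carrier_mat n n" for M
      using that ab R by (simp add: scalar_prod_def atLeast0LessThan)
    from this[OF mult_carrier_mat[OF E RT(2)]]
    have "(?R * (E * ?T)) $$ (a, b) = (\<Sum>k<n. \<Sum>l<n. e (k, l) * R $$ (k, a) * T $$ (b, l))"
      by (simp add: ET sum_distrib_left mult_ac)
    then show "(?R * (E * ?T)) $$ (a, b) = 0\<^sub>m n n $$ (a, b)" using zero[OF ab] ab by simp
  qed (use R T in auto)
  then have "P * (?R * (E * ?T)) * Q = P * 0\<^sub>m n n * Q" by simp
  then have "(P * ?R) * E * (?T * Q) = 0\<^sub>m n n"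
    using P(1) Q(1) RT E by (simp add: assoc_mult_mat[of _ n n _ n _ n] mult_carrier_mat[of _ n n _ n])
  then have "E = 0\<^sub>m n n" using P(2) Q(2) E by simp
  then have "E $$ (k, l) = 0" using kl by simp
  then show ?thesis using kl by (simp add: E_def)
qed

lemma std_gaussian_char: "(\<integral>x. iexp (t * x) \<partial>std_gaussian) = of_real (exp (- t\<^sup>2 / 2))"
  using fun_cong[OF char_std_normal_distribution, of t] by (simp add: char_def std_gaussian_def)

text \<open>Pairing the exponents \<open>e\<close> with \<open>R * X \<omega> * T\<close> is the
  same as pairing \<open>m\<close> with \<open>X \<omega>\<close>. The integrand is thus a product
  of exponentials in the independent entries, and each contributes the Gaussian characteristic
  function at \<open>\<gamma> * m i\<close>.\<close>

lemma integral_phase_monomial: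
  fixes R T :: "real mat" and X :: "'a \<Rightarrow> real mat" and e :: "nat \<times> nat \<Rightarrow> int"
  assumes M: "prob_space M" and X: "iid_matrix M n std_gaussian X"
    and R: "R \<in> carrier_mat n n" and T: "T \<in> carrier_mat n n"
  defines "I \<equiv> {..<n} \<times> {..<n}"
  defines "m \<equiv> \<lambda>(a, b). \<Sum>k<n. \<Sum>l<n. of_int (e (k, l)) * R $$ (k, a) * T $$ (b, l)"
  shows "(\<integral>\<omega>. (\<Prod>i\<in>I. pad n (phase_matrix \<gamma> (R * X \<omega> * T)) i powi e i) \<partial>M) =
    (\<Prod>i\<in>I. of_real (exp (- (\<gamma> * m i)\<^sup>2 / 2)))"
proof -
  interpret prob_space M by fact
  have eq: "(\<Prod>i\<in>I. pad n (phase_matrix \<gamma> (R * X \<omega> * T)) i powi e i) = (\<Prod>i\<in>I. iexp (\<gamma> * m i * X \<omega> $$ i))"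
    if \<omega>: "\<omega> \<in> space M" for \<omega>
  proof -
    have X\<omega>: "X \<omega> \<in> carrier_mat n n" using X \<omega> by (simp add: iid_matrix_def)
    have RX: "(R * X \<omega>) $$ (k, b) = (\<Sum>a<n. R $$ (k, a) * X \<omega> $$ (a, b))" if "k < n" "b < n" for k b
      using that R X\<omega> by (simp add: scalar_prod_def atLeast0LessThan)
    have \<theta>: "(R * X \<omega> * T) $$ (k, l) = (\<Sum>a<n. \<Sum>b<n. R $$ (k, a) * X \<omega> $$ (a, b) * T $$ (b, l))"
      if "k < n" "l < n" for k l
    proof -
      have "(Y * T) $$ (k, l) = (\<Sum>b<n. Y $$ (k, b) * T $$ (b, l))" if "Y \<in> carrier_mat n n" for Y
        using that \<open>k < n\<close> \<open>l < n\<close> T by (simp add: scalar_prod_def atLeast0LessThan)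
      from this[OF mult_carrier_mat[OF R X\<omega>]]
      have "(R * X \<omega> * T) $$ (k, l) = (\<Sum>b<n. \<Sum>a<n. R $$ (k, a) * X \<omega> $$ (a, b) * T $$ (b, l))"
        using \<open>k < n\<close> by (simp add: RX sum_distrib_right)
      also have "\<dots> = (\<Sum>a<n. \<Sum>b<n. R $$ (k, a) * X \<omega> $$ (a, b) * T $$ (b, l))" by (rule sum.swap)
      finally show ?thesis .
    qed
    \<comment> \<open>Exchanging the two double sums moves the linear form from the entries of the
      product to those of \<open>X \<omega>\<close>.\<close>
    have "(\<Sum>(k, l)\<in>I. of_int (e (k, l)) * (R * X \<omega> * T) $$ (k, l)) =
        (\<Sum>(k, l)\<in>I. \<Sum>(a, b)\<in>I. of_int (e (k, l)) * R $$ (k, a) * T $$ (b, l) * X \<omega> $$ (a, b))"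
      unfolding I_def
      by (intro sum.cong refl) (auto simp: \<theta> sum_distrib_left mult_ac simp flip: sum.cartesian_product)
    also have "\<dots> = (\<Sum>(a, b)\<in>I. \<Sum>(k, l)\<in>I. of_int (e (k, l)) * R $$ (k, a) * T $$ (b, l) * X \<omega> $$ (a, b))"
      using sum.swap[of "\<lambda>(k, l) (a, b). of_int (e (k, l)) * R $$ (k, a) * T $$ (b, l) * X \<omega> $$ (a, b)" I I]
      by (simp add: case_prod_unfold)
    also have "\<dots> = (\<Sum>i\<in>I. m i * X \<omega> $$ i)"
      unfolding I_def m_def
      by (intro sum.cong refl) (auto simp: sum_distrib_right simp flip: sum.cartesian_product)
    finally have lin: "(\<Sum>i\<in>I. of_int (e i) * (R * X \<omega> * T) $$ i) = (\<Sum>i\<in>I. m i * X \<omega> $$ i)"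
      by (simp add: case_prod_unfold)
    have "(\<Prod>i\<in>I. pad n (phase_matrix \<gamma> (R * X \<omega> * T)) i powi e i) =
        (\<Prod>i\<in>I. exp (of_int (e i) * (of_real \<gamma> * \<i> * of_real ((R * X \<omega> * T) $$ i))))"
      using R T by (intro prod.cong refl) (auto simp: I_def pad_def phase_matrix_def exp_power_int)
    also have "\<dots> = exp (\<Sum>i\<in>I. of_int (e i) * (of_real \<gamma> * \<i> * of_real ((R * X \<omega> * T) $$ i)))"
      by (rule exp_sum[symmetric]) (simp add: I_def)
    also have "(\<Sum>i\<in>I. of_int (e i) * (of_real \<gamma> * \<i> * of_real ((R * X \<omega> * T) $$ i))) =
        of_real \<gamma> * \<i> * of_real (\<Sum>i\<in>I. of_int (e i) * (R * X \<omega> * T) $$ i)"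
      by (simp add: sum_distrib_left mult_ac)
    also have "\<dots> = (\<Sum>i\<in>I. \<i> * of_real (\<gamma> * m i * X \<omega> $$ i))"
      unfolding lin by (simp add: sum_distrib_left mult_ac)
    also have "exp \<dots> = (\<Prod>i\<in>I. iexp (\<gamma> * m i * X \<omega> $$ i))"
      by (rule exp_sum) (simp add: I_def)
    finally show ?thesis .
  qed
  have "(\<integral>\<omega>. (\<Prod>i\<in>I. pad n (phase_matrix \<gamma> (R * X \<omega> * T)) i powi e i) \<partial>M) =
      (\<integral>\<omega>. (\<Prod>i\<in>I. iexp (\<gamma> * m i * X \<omega> $$ i)) \<partial>M)"
    by (intro Bochner_Integration.integral_cong refl eq)
  also have "\<dots> = (\<Prod>i\<in>I. \<integral>x. iexp (\<gamma> * m i * x) \<partial>std_gaussian)"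
    unfolding I_def
  proof (rule integral_iid_prod[OF M X])
    fix i assume "i \<in> {..<n} \<times> {..<n}"
    then obtain a b where i: "i = (a, b)" "a < n" "b < n" by auto
    note iid_matrix_measurable[OF M X i(2,3), measurable]
    show "integrable M (\<lambda>\<omega>. iexp (\<gamma> * m i * X \<omega> $$ i))"
      unfolding i(1) by (rule integrable_const_bound[where B = 1]) auto
  qed auto
  finally show ?thesis by (simp only: std_gaussian_char)
qed

lemma tendsto_exp_neg_square: "((\<lambda>\<gamma> :: real. exp (- (\<gamma> * m)\<^sup>2 / 2)) \<longlongrightarrow> (if m = 0 then 1 else 0)) at_top"
proof (cases "m = 0")
  case False
  have "filterlim (\<lambda>\<gamma> :: real. - (m\<^sup>2 / 2) * \<gamma>\<^sup>2) at_bot at_top"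
    by (rule filterlim_tendsto_neg_mult_at_bot[OF tendsto_const])
       (use False in \<open>auto intro!: filterlim_pow_at_top filterlim_ident\<close>)
  from filterlim_compose[OF exp_at_bot this] False show ?thesis by (simp add: power_mult_distrib mult_ac)
qed simp

text \<open>Each Gaussian factor tends to 1 or 0 according to whether \<open>m i\<close> vanishes,
  and invertibility of \<open>R\<close> and \<open>T\<close> keeps \<open>m\<close> from vanishing
  identically unless \<open>e\<close> does.\<close>

lemma tendsto_phase_monomial:
  fixes R T :: "real mat" and X :: "'a \<Rightarrow> real mat"
  assumes M: "prob_space M" and X: "iid_matrix M n std_gaussian X"
    and R: "R \<in> carrier_mat n n" "det R \<noteq> 0" and T: "T \<in> carrier_mat n n" "det T \<noteq> 0"
  shows "((\<lambda>\<gamma>. \<integral>\<omega>. (\<Prod>i\<in>{..<n} \<times> {..<n}. pad n (phase_matrix \<gamma> (R * X \<omega> * T)) i powi e i) \<partial>M) \<longlongrightarrow>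
    (\<Prod>i\<in>{..<n} \<times> {..<n}. if e i = 0 then 1 else 0)) at_top"
proof -
  let ?I = "{..<n} \<times> {..<n}"
  define m where "m = (\<lambda>(a, b). \<Sum>k<n. \<Sum>l<n. real_of_int (e (k, l)) * R $$ (k, a) * T $$ (b, l))"
  have "((\<lambda>\<gamma>. \<Prod>i\<in>?I. complex_of_real (exp (- (\<gamma> * m i)\<^sup>2 / 2))) \<longlongrightarrow>
     (\<Prod>i\<in>?I. complex_of_real (if m i = 0 then 1 else 0))) at_top"
    by (intro tendsto_prod tendsto_of_real tendsto_exp_neg_square)
  \<comment> \<open>The products need not agree factor by factor: both are 1 when \<open>e\<close>
    vanishes on the index set, and otherwise each contains some factor 0.\<close>
  moreover have "(\<Prod>i\<in>?I. complex_of_real (if m i = 0 then 1 else 0)) = (\<Prod>i\<in>?I. if e i = 0 then 1 else 0)"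
  proof (cases "\<forall>i\<in>?I. e i = 0")
    case True
    then have "m i = 0" for i by (cases i) (auto simp: m_def intro!: sum.neutral)
    moreover have "(\<Prod>i\<in>?I. if e i = 0 then 1 else 0 :: complex) = 1"
      using True by (intro prod.neutral) auto
    ultimately show ?thesis by simp
  next
    case False
    then obtain k l where kl: "k < n" "l < n" "e (k, l) \<noteq> 0" by auto
    have "\<exists>i\<in>?I. m i \<noteq> 0"
    proof (rule ccontr)
      assume "\<not> ?thesis"
      then have "(\<Sum>k<n. \<Sum>l<n. real_of_int (e (k, l)) * R $$ (k, a) * T $$ (b, l)) = 0" if "a < n" "b < n" for a b
        using that by (auto simp: m_def)
      from bilinear_coefficients_eq_0[OF R T, of "\<lambda>i. real_of_int (e i)", OF this kl(1,2)] kl(3)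
      show False by simp
    qed
    then have "(\<Prod>i\<in>?I. complex_of_real (if m i = 0 then 1 else 0)) = 0"
      by (intro prod_zero) auto
    moreover have "(\<Prod>i\<in>?I. if e i = 0 then 1 else 0 :: complex) = 0"
      using False by (intro prod_zero) auto
    ultimately show ?thesis by (simp only:)
  qed
  ultimately show ?thesis
    unfolding integral_phase_monomial[OF M X R(1) T(1)] m_def by simp
qed

text \<open>Continuous mapping: the eigenvalue vector is a continuous function \<open>\<Phi>\<close>
  of the padded entries, so composing a test function with \<open>\<Phi>\<close> gives a continuous
  function on the torus, where convergence of the monomials is enough.\<close>

lemma eigenvalues_phase_matrix_converge:
  fixes R T :: "real mat" and X :: "'a \<Rightarrow> real mat"
  assumes M: "prob_space M" and X: "iid_matrix M n std_gaussian X"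
    and R: "R \<in> carrier_mat n n" "det R \<noteq> 0" and T: "T \<in> carrier_mat n n" "det T \<noteq> 0"
    and M': "prob_space M'" and U: "iid_matrix M' n circle_uniform U"
  shows "converges_in_distribution
          M (\<lambda>\<gamma> \<omega>. eigenvalue_vector (gram (phase_matrix \<gamma> (R * X \<omega> * T))))
          M' (\<lambda>\<omega>. eigenvalue_vector (gram (U \<omega>))) at_top"
proof -
  let ?I = "{..<n} \<times> {..<n}"
  define \<Phi> where "\<Phi> = (\<lambda>p. eigenvalue_vector (gram (mat n n p)))"
  define Y where "Y \<gamma> \<omega> = pad n (phase_matrix \<gamma> (R * X \<omega> * T))" for \<gamma> \<omega>
  define Z where "Z \<omega> = pad n (U \<omega>)" for \<omega>
  have \<Phi>: "continuous_on UNIV \<Phi>" unfolding \<Phi>_def by (rule continuous_on_eigenvalue_vector_gram)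
  have XC: "X \<omega> \<in> carrier_mat n n" if "\<omega> \<in> space M" for \<omega> using X that by (simp add: iid_matrix_def)
  have PC: "phase_matrix \<gamma> (R * X \<omega> * T) \<in> carrier_mat n n" for \<gamma> \<omega>
    using R T by (auto simp: phase_matrix_def)
  have \<Phi>Y: "eigenvalue_vector (gram (phase_matrix \<gamma> (R * X \<omega> * T))) = \<Phi> (Y \<gamma> \<omega>)" for \<gamma> \<omega>
    unfolding \<Phi>_def Y_def mat_pad[OF PC] ..
  have \<Phi>Z: "eigenvalue_vector (gram (U \<omega>)) = \<Phi> (Z \<omega>)" if "\<omega> \<in> space M'" for \<omega>
    using U that unfolding \<Phi>_def Z_def iid_matrix_def by (simp add: mat_pad)
  have Ym: "(\<lambda>\<omega>. Y \<gamma> \<omega> i) \<in> borel_measurable M" for \<gamma> i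
  proof (cases "i \<in> ?I")
    case True
    then obtain k l where i: "i = (k, l)" "k < n" "l < n" by auto
    have "(\<lambda>\<omega>. \<Sum>b<n. (\<Sum>a<n. R $$ (k, a) * X \<omega> $$ (a, b)) * T $$ (b, l)) \<in> borel_measurable M"
      by (intro borel_measurable_sum borel_measurable_times borel_measurable_const iid_matrix_measurable[OF M X])
         (use i in auto)
    moreover have "(\<lambda>x. exp (of_real \<gamma> * \<i> * complex_of_real x)) \<in> borel_measurable borel"
      by (intro borel_measurable_continuous_onI continuous_intros)
    ultimately have "(\<lambda>\<omega>. exp (of_real \<gamma> * \<i> * complex_of_real (\<Sum>b<n. (\<Sum>a<n. R $$ (k, a) * X \<omega> $$ (a, b)) * T $$ (b, l)))) \<in> borel_measurable M"
      by (rule measurable_compose)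
    \<comment> \<open>The dimensions of \<open>X \<omega>\<close> are known on
      \<open>space M\<close>, so the entry formula is established there.\<close>
    also have "?this \<longleftrightarrow> ?thesis"
    proof (rule measurable_cong)
      fix \<omega> assume \<omega>: "\<omega> \<in> space M"
      have RX: "(R * X \<omega>) $$ (k, b) = (\<Sum>a<n. R $$ (k, a) * X \<omega> $$ (a, b))" if "b < n" for b
        using that i R XC[OF \<omega>] by (simp add: scalar_prod_def atLeast0LessThan)
      have "(B * T) $$ (k, l) = (\<Sum>b<n. B $$ (k, b) * T $$ (b, l))" if "B \<in> carrier_mat n n" for B
        using that i T by (simp add: scalar_prod_def atLeast0LessThan)
      from this[OF mult_carrier_mat[OF R(1) XC[OF \<omega>]]]
      have "(R * X \<omega> * T) $$ (k, l) = (\<Sum>b<n. (\<Sum>a<n. R $$ (k, a) * X \<omega> $$ (a, b)) * T $$ (b, l))"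
        by (simp add: RX)
      then show "exp (of_real \<gamma> * \<i> * of_real (\<Sum>b<n. (\<Sum>a<n. R $$ (k, a) * X \<omega> $$ (a, b)) * T $$ (b, l))) = Y \<gamma> \<omega> i"
        using i R T by (simp add: Y_def pad_def phase_matrix_def)
    qed
    finally show ?thesis .
  qed (simp add: Y_def pad_def)
  have Zm: "(\<lambda>\<omega>. Z \<omega> i) \<in> borel_measurable M'" for i
    by (cases "i \<in> ?I") (auto simp: Z_def pad_def intro: iid_matrix_measurable[OF M' U])
  have Yt: "Y \<gamma> \<omega> \<in> torus ?I" for \<gamma> \<omega>
    using R T by (auto simp: Y_def torus_def pad_def phase_matrix_def)
  have Zt: "AE \<omega> in M'. Z \<omega> \<in> torus ?I"
    unfolding Z_def by (rule iid_circle_uniform_torus[OF M' U])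
  have \<Phi>m: "\<Phi> \<in> borel_measurable borel" by (rule borel_measurable_continuous_onI[OF \<Phi>])
  have Yb: "Y \<gamma> \<in> borel_measurable M" for \<gamma> by (rule measurable_coordinatewise_then_product[OF Ym])
  have Zb: "Z \<in> borel_measurable M'" by (rule measurable_coordinatewise_then_product[OF Zm])
  show ?thesis
    unfolding converges_in_distribution_def \<Phi>Y
  proof (intro conjI allI impI always_eventually)
    show "(\<lambda>\<omega>. \<Phi> (Y \<gamma> \<omega>)) \<in> borel_measurable M" for \<gamma>
      by (rule measurable_compose[OF Yb \<Phi>m])
    show "(\<lambda>\<omega>. eigenvalue_vector (gram (U \<omega>))) \<in> borel_measurable M'"
      using measurable_compose[OF Zb \<Phi>m] by (simp add: \<Phi>Z cong: measurable_cong)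
    fix f :: "(nat \<Rightarrow> real) \<Rightarrow> real"
    assume "continuous_on UNIV f \<and> bounded (range f)"
    then have f: "continuous_on UNIV f" by simp
    have f\<Phi>: "continuous_on UNIV (\<lambda>p. f (\<Phi> p))"
      by (rule continuous_on_compose2[OF f \<Phi>]) auto
    have f\<Phi>m: "(\<lambda>p. f (\<Phi> p)) \<in> borel_measurable borel" by (rule borel_measurable_continuous_onI[OF f\<Phi>])
    have "((\<lambda>\<gamma>. \<integral>\<omega>. f (\<Phi> (Y \<gamma> \<omega>)) \<partial>M) \<longlongrightarrow> (\<integral>\<omega>. f (\<Phi> (Z \<omega>)) \<partial>M')) at_top"
    proof (rule torus_convergence[where f = "\<lambda>p. f (\<Phi> p)", OF _ M M' Ym _ Zm Zt])
      show "((\<lambda>\<gamma>. \<integral>\<omega>. (\<Prod>i\<in>?I. Y \<gamma> \<omega> i powi e i) \<partial>M) \<longlongrightarrow> (\<integral>\<omega>. (\<Prod>i\<in>?I. Z \<omega> i powi e i) \<partial>M')) at_top" for e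
        unfolding Y_def Z_def integral_circle_monomial[OF M' U]
        by (rule tendsto_phase_monomial[OF M X R T])
      show "continuous_on (torus ?I) (\<lambda>p. f (\<Phi> p))" by (rule continuous_on_subset[OF f\<Phi>]) auto
    qed (auto intro: Yt measurable_compose[OF Yb f\<Phi>m] measurable_compose[OF Zb f\<Phi>m])
    also have "(\<integral>\<omega>. f (\<Phi> (Z \<omega>)) \<partial>M') = (\<integral>\<omega>. f (eigenvalue_vector (gram (U \<omega>))) \<partial>M')"
      by (intro Bochner_Integration.integral_cong refl) (simp add: \<Phi>Z)
    finally show "((\<lambda>\<gamma>. \<integral>\<omega>. f (\<Phi> (Y \<gamma> \<omega>)) \<partial>M) \<longlongrightarrow> (\<integral>\<omega>. f (eigenvalue_vector (gram (U \<omega>))) \<partial>M')) at_top" .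
  qed
qed

theorem theorem1:
  fixes M :: "'a measure"
    and R T :: "nat \<Rightarrow> real mat"
    and X :: "nat \<Rightarrow> 'a \<Rightarrow> real mat"
    and \<theta> :: "nat \<Rightarrow> 'a \<Rightarrow> real mat"
    and A :: "nat \<Rightarrow> real \<Rightarrow> 'a \<Rightarrow> complex mat"
  assumes "prob_space M"
    and "\<And>N. N \<ge> 1 \<Longrightarrow> symmetric_psd N (R N) \<and> vec_space.rank N (R N) = N"
    and "\<And>N. N \<ge> 1 \<Longrightarrow> symmetric_psd N (T N) \<and> vec_space.rank N (T N) = N"
    and "\<And>N. N \<ge> 1 \<Longrightarrow> iid_matrix M N std_gaussian (X N)"
  defines "\<theta> \<equiv> \<lambda>N \<omega>. R N * X N \<omega> * T N"
    and "A \<equiv> \<lambda>N \<gamma> \<omega>. phase_matrix \<gamma> (\<theta> N \<omega>)"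
  shows
    "(\<forall>N \<ge> 1. \<forall>(M' :: 'b measure) U.
        prob_space M' \<longrightarrow> iid_matrix M' N circle_uniform U \<longrightarrow>
        converges_in_distribution
          M (\<lambda>\<gamma> \<omega>. eigenvalue_vector (gram (A N \<gamma> \<omega>)))
          M' (\<lambda>\<omega>. eigenvalue_vector (gram (U \<omega>))) at_top)
     \<and>
     (\<forall>(F :: real measure) (\<gamma> :: nat \<Rightarrow> real).
        real_distribution F \<longrightarrow> compactly_supported F \<longrightarrow>
        (AE \<omega> in M. weak_conv_m (\<lambda>N. esd (gram (map_mat complex_of_real (\<theta> N \<omega>)))) F) \<longrightarrow>
        (AE \<omega> in M. convergent (\<lambda>N. operator_norm (gram (map_mat complex_of_real (\<theta> N \<omega>))))) \<longrightarrow>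
        (\<forall>N \<ge> 1. \<gamma> N > 0) \<longrightarrow> \<gamma> \<longlonglongrightarrow> 0 \<longrightarrow>
        (AE \<omega> in M. weak_conv_m
           (\<lambda>N. esd (complex_of_real (1 / (\<gamma> N)\<^sup>2) \<cdot>\<^sub>m gram (A N (\<gamma> N) \<omega>))) F))"
proof -
  \<comment> \<open>Full rank enters as a nonzero determinant.\<close>
  have full_rank: "B \<in> carrier_mat N N \<and> det B \<noteq> 0"
    if "symmetric_psd N B \<and> vec_space.rank N B = N" for N and B :: "real mat"
    using that vec_space.det_rank_iff[of B N] unfolding symmetric_psd_def by blast
  have R: "R N \<in> carrier_mat N N" "det (R N) \<noteq> 0" and T: "T N \<in> carrier_mat N N" "det (T N) \<noteq> 0"
    if "N \<ge> 1" for N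
    using full_rank[OF assms(2)[OF that]] full_rank[OF assms(3)[OF that]] by simp_all
  have \<theta>: "\<theta> N \<omega> \<in> carrier_mat N N" if "N \<ge> 1" for N \<omega>
    using R(1)[OF that] T(1)[OF that] by (auto simp: \<theta>_def)
  show ?thesis
  proof (intro conjI allI impI)
    fix N :: nat and M' :: "'b measure" and U
    assume "N \<ge> 1" "prob_space M'" "iid_matrix M' N circle_uniform U"
    then show "converges_in_distribution M (\<lambda>\<gamma> \<omega>. eigenvalue_vector (gram (A N \<gamma> \<omega>)))
          M' (\<lambda>\<omega>. eigenvalue_vector (gram (U \<omega>))) at_top"
      unfolding A_def \<theta>_def
      by (intro eigenvalues_phase_matrix_converge[OF assms(1) assms(4)] R T)
  next
    fix F :: "real measure" and \<gamma> :: "nat \<Rightarrow> real"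
    assume F: "real_distribution F" and \<gamma>: "\<forall>N \<ge> 1. \<gamma> N > 0" "\<gamma> \<longlonglongrightarrow> 0"
      and conv: "AE \<omega> in M. weak_conv_m (\<lambda>N. esd (gram (map_mat complex_of_real (\<theta> N \<omega>)))) F"
      and bounded: "AE \<omega> in M. convergent (\<lambda>N. operator_norm (gram (map_mat complex_of_real (\<theta> N \<omega>))))"
    \<comment> \<open>On the intersection of the two almost sure events the deterministic statement
      applies outcome by outcome.\<close>
    from conv bounded
    show "AE \<omega> in M. weak_conv_m (\<lambda>N. esd (complex_of_real (1 / (\<gamma> N)\<^sup>2) \<cdot>\<^sub>m gram (A N (\<gamma> N) \<omega>))) F"
    proof eventually_elim
      case (elim \<omega>)
      then show ?case
        unfolding A_def by (intro weak_conv_phase_matrix \<theta> F \<gamma>(2)) (use \<gamma>(1) in auto)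
    qed
  qed
qed

end
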